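(* Let $A$ be a real $d\times d$ matrix all of whose eigenvalues have strictly negative real parts and let $B$ be a real $d\times m$ matrix such that $(A,B)$ is a controllable pair. Let $v$ be the stationary solution of $dv(t)=Av(t)\,dt+B\,dW(t)$. Fix $\alpha\in\mathbb{R}^d$, let $V(t)=\langle\alpha,v(t)\rangle$ and let $\xi(t)=\dot V(t)=\langle a,v(t)\rangle+\langle\gamma,\dot W(t)\rangle$ where $a=A^*\alpha$ and $\gamma=B^*\alpha$. For $\omega\neq 0$ let $$\lambda_2(\omega)=\frac{\pi}{\omega^2}\Bigl(\langle a,\widehat S_A(\omega)Ra\rangle+\langle a,\widehat S_A(\omega)B\gamma\rangle+\frac{\|\gamma\|^2}{2\pi}\Bigr)$$ with this choice of $a$ and $\gamma$. Then $$\lambda_2(\omega)=\pi S_V(\omega).$$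
   Context: $W$ is a standard $m$-dimensional Brownian motion. $(A,B)$ is a controllable pair if $\mathrm{rank}\{B,AB,\dots,A^{d-1}B\}=d$. The stationary solution is $v(t)=\int_{-\infty}^te^{(t-s)A}B\,dW(s)$; its covariance matrix is $R=\int_0^\infty e^{tA}BB^*e^{tA^*}\,dt$. The matrix valued cosine transform of $A$ is $\widehat S_A(\omega)=\frac1\pi\int_0^\infty e^{tA}\cos\omega t\,dt$. For an $L^2$ stationary mean-zero scalar process $X$, the power spectral density is $S_X(\omega)=\frac1{2\pi}\int_{-\infty}^\infty\mathbb{E}[X(t)X(0)]e^{-i\omega t}\,dt=\frac1\pi\int_0^\infty\mathbb{E}[X(t)X(0)]\cos\omega t\,dt$. *)

theory Defs
  imports "HOL-Probability.Probability"
begin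

text \<open>On the type \<^typ>\<open>real^'n^'n\<close> the operations \<open>*\<close>, \<open>^\<close> of the library act componentwise,
  so matrix powers and the matrix exponential are built from the matrix product \<open>**\<close>.\<close>

definition matpow :: "real^'n^'n \<Rightarrow> nat \<Rightarrow> real^'n^'n" where
  "matpow A k = (((**) A) ^^ k) (mat 1)"

definition mexp :: "real^'n^'n \<Rightarrow> real^'n^'n" where
  "mexp A = (\<Sum>k. (1 / fact k) *\<^sub>R matpow A k)"

definition eigenvalue_of :: "real^'n^'n \<Rightarrow> complex \<Rightarrow> bool" where
  "eigenvalue_of A \<mu> \<longleftrightarrow> (\<exists>x. x \<noteq> 0 \<and> map_matrix complex_of_real A *v x = \<mu> *s x)"

text \<open>The rank of the block matrix \<open>[B, AB, \<dots>, A^(d-1) B]\<close> is the dimension of the span of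
  the columns of all its blocks.\<close>

definition controllable :: "real^'d^'d \<Rightarrow> real^'m^'d \<Rightarrow> bool" where
  "controllable A B \<longleftrightarrow> dim (\<Union>k<CARD('d). columns (matpow A k ** B)) = CARD('d)"

text \<open>Since the stationary solution integrates from \<open>-\<infinity>\<close>, Brownian motion is indexed by the
  whole real line. The density \<^term>\<open>normal_density 0 \<sigma>\<close> takes the standard deviation \<open>\<sigma>\<close>.\<close>

definition brownian_motion :: "'w measure \<Rightarrow> (real \<Rightarrow> 'w \<Rightarrow> real^'m) \<Rightarrow> bool" where
  "brownian_motion M W \<longleftrightarrow>
     prob_space M \<and>
     (\<forall>t. W t \<in> borel_measurable M) \<and>
     (AE x in M. W 0 x = 0) \<and>
     (AE x in M. continuous_on UNIV (\<lambda>t. W t x)) \<and>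
     (\<forall>(t :: nat \<Rightarrow> real) n. (\<forall>k<n. t k < t (Suc k)) \<longrightarrow>
        prob_space.indep_vars M (\<lambda>_. borel) (\<lambda>k x. W (t (Suc k)) x - W (t k) x) {..<n}) \<and>
     (\<forall>s t. s < t \<longrightarrow>
        prob_space.indep_vars M (\<lambda>_. borel) (\<lambda>i x. (W t x - W s x) $ i) UNIV \<and>
        (\<forall>i. distributed M lborel (\<lambda>x. (W t x - W s x) $ i)
               (\<lambda>y. ennreal (normal_density 0 (sqrt (t - s)) y))))"

definition step_fun :: "nat \<Rightarrow> (nat \<Rightarrow> real) \<Rightarrow> (nat \<Rightarrow> real^'m^'d) \<Rightarrow> real \<Rightarrow> real^'m^'d" where
  "step_fun n t C s = (\<Sum>k<n. indicator {t k<..t (Suc k)} s *\<^sub>R C k)"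

definition step_integral ::
    "(real \<Rightarrow> 'w \<Rightarrow> real^'m) \<Rightarrow> nat \<Rightarrow> (nat \<Rightarrow> real) \<Rightarrow> (nat \<Rightarrow> real^'m^'d) \<Rightarrow> 'w \<Rightarrow> real^'d" where
  "step_integral W n t C x = (\<Sum>k<n. C k *v (W (t (Suc k)) x - W (t k) x))"

text \<open>\<open>X = \<integral> f(s) dW(s)\<close> over the real line, for a deterministic matrix-valued \<open>f\<close>: the integrals
  of some step functions tending to \<open>f\<close> in \<open>L\<^sup>2\<close> tend to \<open>X\<close> in \<open>L\<^sup>2\<close>. By the Ito isometry the
  limit does not depend on the chosen step functions, and \<open>X\<close> is determined almost surely.\<close>

definition has_wiener_integral ::
    "'w measure \<Rightarrow> (real \<Rightarrow> 'w \<Rightarrow> real^'m) \<Rightarrow> (real \<Rightarrow> real^'m^'d) \<Rightarrow> ('w \<Rightarrow> real^'d) \<Rightarrow> bool" where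
  "has_wiener_integral M W f X \<longleftrightarrow>
     f \<in> borel_measurable lborel \<and> X \<in> borel_measurable M \<and>
     (\<exists>(n :: nat \<Rightarrow> nat) (t :: nat \<Rightarrow> nat \<Rightarrow> real) (C :: nat \<Rightarrow> nat \<Rightarrow> real^'m^'d).
        (\<forall>j. \<forall>k<n j. t j k < t j (Suc k)) \<and>
        (\<lambda>j. \<integral>\<^sup>+s. ennreal ((norm (f s - step_fun (n j) (t j) (C j) s))\<^sup>2) \<partial>lborel)
          \<longlonglongrightarrow> 0 \<and>
        (\<lambda>j. \<integral>\<^sup>+x. ennreal ((norm (X x - step_integral W (n j) (t j) (C j) x))\<^sup>2) \<partial>M)
          \<longlonglongrightarrow> 0)"

text \<open>White noise has no pointwise values, so \<open>dv(t) = A v(t) dt + B dW(t)\<close> is stated in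
  integrated form along continuous paths. The identity \<open>dV/dt = \<langle>a, v\<rangle> + \<langle>\<gamma>, dW/dt\<rangle>\<close> for
  \<open>V = \<langle>\<alpha>, v\<rangle>\<close> is to be read in the same way.\<close>

definition solves_linear_sde ::
    "'w measure \<Rightarrow> (real \<Rightarrow> 'w \<Rightarrow> real^'m) \<Rightarrow> real^'d^'d \<Rightarrow> real^'m^'d \<Rightarrow> (real \<Rightarrow> 'w \<Rightarrow> real^'d) \<Rightarrow> bool"
  where
  "solves_linear_sde M W A B v \<longleftrightarrow>
     (AE x in M. continuous_on UNIV (\<lambda>t. v t x) \<and>
        (\<forall>s t. s \<le> t \<longrightarrow>
           v t x - v s x = integral {s..t} (\<lambda>r. A *v v r x) + B *v (W t x - W s x)))"

text \<open>The formula \<open>v(t) = \<integral>\<^bsub>-\<infinity>\<^esub>\<^bsup>t\<^esup> e^((t-s)A) B dW(s)\<close> fixes each \<open>v(t)\<close> almost surely only;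
  the first conjunct selects the version with continuous paths.\<close>

definition stationary_solution ::
    "'w measure \<Rightarrow> (real \<Rightarrow> 'w \<Rightarrow> real^'m) \<Rightarrow> real^'d^'d \<Rightarrow> real^'m^'d \<Rightarrow> (real \<Rightarrow> 'w \<Rightarrow> real^'d) \<Rightarrow> bool"
  where
  "stationary_solution M W A B v \<longleftrightarrow>
     solves_linear_sde M W A B v \<and>
     (\<forall>t. has_wiener_integral M W
            (\<lambda>s. indicator {..t} s *\<^sub>R (mexp ((t - s) *\<^sub>R A) ** B)) (v t))"

definition stationary_cov :: "real^'d^'d \<Rightarrow> real^'m^'d \<Rightarrow> real^'d^'d" where
  "stationary_cov A B =
     (LINT t:{0..}|lborel. mexp (t *\<^sub>R A) ** B ** transpose B ** mexp (t *\<^sub>R transpose A))"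

definition cosine_transform :: "real^'d^'d \<Rightarrow> real \<Rightarrow> real^'d^'d" where
  "cosine_transform A \<omega> = (1 / pi) *\<^sub>R (LINT t:{0..}|lborel. cos (\<omega> * t) *\<^sub>R mexp (t *\<^sub>R A))"

definition power_spectral_density :: "'w measure \<Rightarrow> (real \<Rightarrow> 'w \<Rightarrow> real) \<Rightarrow> real \<Rightarrow> complex" where
  "power_spectral_density M X \<omega> =
     1 / (2 * complex_of_real pi) *
     (LINT t|lborel. complex_of_real (LINT x|M. X t x * X 0 x) * exp (- \<i> * complex_of_real (\<omega> * t)))"

definition lambda2 ::
    "real^'d^'d \<Rightarrow> real^'m^'d \<Rightarrow> real^'d \<Rightarrow> real^'m \<Rightarrow> real \<Rightarrow> real" where
  "lambda2 A B a \<gamma> \<omega> =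
     pi / \<omega>\<^sup>2 *
     (a \<bullet> (cosine_transform A \<omega> *v (stationary_cov A B *v a)) +
      a \<bullet> (cosine_transform A \<omega> *v (B *v \<gamma>)) +
      (norm \<gamma>)\<^sup>2 / (2 * pi))"

end

theory Submission
  imports Defs "HOL-Computational_Algebra.Fundamental_Theorem_Algebra"
begin

text \<open>
  By the isometry of the Wiener integral, \<open>E[V(t) V(s)] = \<langle>\<alpha>, e\<^bsup>(t-s)A\<^esup> R \<alpha>\<rangle>\<close> for \<open>s \<le> t\<close>,
  so that \<open>\<pi> S\<^sub>V(\<omega>) = \<pi> \<langle>\<alpha>, S R \<alpha>\<rangle>\<close>, where \<open>S\<close> is the cosine transform of \<open>A\<close>. Integrating
  derivatives over the half line gives the Lyapunov equation \<open>A R + R A\<^sup>* = - B B\<^sup>*\<close> and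
  \<open>A\<^sup>2 S + \<omega>\<^sup>2 S = - A / \<pi>\<close>. Hence \<open>A S (R A\<^sup>* + B B\<^sup>*) = - A\<^sup>2 S R = \<omega>\<^sup>2 S R + A R / \<pi>\<close>, and the last
  term contributes \<open>\<langle>\<alpha>, A R \<alpha>\<rangle> / \<pi> = - \<parallel>B\<^sup>* \<alpha>\<parallel>\<^sup>2 / (2 \<pi>)\<close>, which cancels the white noise term.
  Exponential decay of \<open>e\<^bsup>tA\<^esup>\<close> makes all of these integrals converge.
\<close>

section \<open>The matrix exponential\<close>

text \<open>Two obstacles shape the proof. The hypothesis on the eigenvalues says nothing directly
  about \<open>mexp\<close>, so its decay has to be produced: a polynomial relation between the
  powers of A splits over the complex numbers into shifts A - r, the shifts at non-eigenvalues are
  cancelled, and one integration per remaining shift bounds each trajectory. A strict margin between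
  the decay rate and the real parts absorbs the polynomial factors that repeated roots would
  otherwise create. Secondly, the Wiener integrals at two times come with unrelated step
  approximations. The isometry is therefore proved in polarised form, for two arbitrary partitions,
  from the covariance of increments over intervals that may overlap in any way. The final algebra
  rests on two further facts: A commutes with S, which is what makes the square of A appear next to
  S, and R is symmetric, so that the Lyapunov equation evaluates the quadratic form of A R as half
  of its right-hand side.\<close>

lemma bounded_bilinear_matrix_matrix_mult:
  "bounded_bilinear ((**) :: real^'n^'m \<Rightarrow> real^'p^'n \<Rightarrow> real^'p^'m)"
  unfolding bilinear_conv_bounded_bilinear [symmetric] bilinear_def
  by (auto intro!: linearI simp: vec_eq_iff matrix_matrix_mult_def sum.distrib sum_distrib_left
      algebra_simps)

lemma bounded_bilinear_matrix_vector_mult: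
  "bounded_bilinear ((*v) :: real^'n^'m \<Rightarrow> real^'n \<Rightarrow> real^'m)"
  unfolding bilinear_conv_bounded_bilinear [symmetric] bilinear_def
  by (auto intro!: linearI simp: vec_eq_iff matrix_vector_mult_def sum.distrib sum_distrib_left
      algebra_simps)

lemma bounded_linear_transpose:
  "bounded_linear (transpose :: real^'n^'m \<Rightarrow> real^'m^'n)"
  unfolding linear_conv_bounded_linear [symmetric]
  by (auto intro!: linearI simp: vec_eq_iff transpose_def)

interpretation mmult: bounded_bilinear
  "(**) :: real^'n^'m \<Rightarrow> real^'p^'n \<Rightarrow> real^'p^'m"
  by (rule bounded_bilinear_matrix_matrix_mult)

interpretation mvmult: bounded_bilinear "(*v) :: real^'n^'m \<Rightarrow> real^'n \<Rightarrow> real^'m"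
  by (rule bounded_bilinear_matrix_vector_mult)

section \<open>Powers and the exponential series of a matrix\<close>

lemma matpow_0 [simp]: "matpow A 0 = mat 1"
  by (simp add: matpow_def)

lemma matpow_Suc: "matpow A (Suc k) = A ** matpow A k"
  by (simp add: matpow_def)

lemma matpow_commute: "A ** matpow A k = matpow A k ** A"
proof (induction k)
  case (Suc k)
  then show ?case by (metis matpow_Suc matrix_mul_assoc)
qed simp

lemma matpow_scaleR: "matpow (t *\<^sub>R A) k = t ^ k *\<^sub>R matpow A k"
  by (induction k) (simp_all add: matpow_Suc mmult.scaleR_left mmult.scaleR_right)

lemma matpow_transpose: "matpow (transpose A) k = transpose (matpow A k)"
proof (induction k)
  case (Suc k)
  then show ?case
    by (metis matpow_Suc matpow_commute matrix_transpose_mul)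
qed (simp add: transpose_mat)

text \<open>Each multiplication costs one factor c from the bilinear bound. Taking
  \<open>norm A * c\<close> as the ratio absorbs them all and leaves a geometric growth, which the
  factorials of the exponential series beat.\<close>

lemma norm_matpow_le: "\<exists>K. \<forall>k. norm (matpow A k) \<le> norm (mat 1 :: real^'n^'n) * K ^ k"
  for A :: "real^'n^'n"
proof -
  obtain c where c: "c > 0" "\<And>(X :: real^'n^'n) (Y :: real^'n^'n). norm (X ** Y) \<le> norm X * norm Y * c"
    using mmult.pos_bounded by blast
  have "norm (matpow A k) \<le> norm (mat 1 :: real^'n^'n) * (norm A * c) ^ k" for k
  proof (induction k)
    case (Suc k)
    have "norm (matpow A (Suc k)) \<le> norm A * norm (matpow A k) * c"
      unfolding matpow_Suc by (rule c)
    also have "\<dots> \<le> norm A * (norm (mat 1 :: real^'n^'n) * (norm A * c) ^ k) * c"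
      using Suc c by (intro mult_right_mono mult_left_mono) auto
    finally show ?case by (simp add: mult_ac)
  qed simp
  then show ?thesis by blast
qed

lemma summable_mexp: "summable (\<lambda>k. (1 / fact k) *\<^sub>R matpow A k)" for A :: "real^'n^'n"
proof -
  obtain K where K: "\<And>k. norm (matpow A k) \<le> norm (mat 1 :: real^'n^'n) * K ^ k"
    using norm_matpow_le by blast
  have "summable (\<lambda>k. norm (mat 1 :: real^'n^'n) * (inverse (fact k) * K ^ k))"
    by (intro summable_mult summable_exp)
  then show ?thesis
    by (rule summable_comparison_test')
      (use K in \<open>simp add: divide_simps mult.commute\<close>)
qed

lemma mexp_sums: "(\<lambda>k. (1 / fact k) *\<^sub>R matpow A k) sums mexp A"
  unfolding mexp_def by (rule summable_sums [OF summable_mexp])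

lemma mexp_0 [simp]: "mexp (0 :: real^'n^'n) = mat 1"
proof -
  have "(\<lambda>k. (1 / fact k) *\<^sub>R matpow 0 k :: real^'n^'n) = (\<lambda>k. if k = 0 then mat 1 else 0)"
    by (auto simp: fun_eq_iff matpow_Suc gr0_conv_Suc)
  then show ?thesis
    using sums_single [of 0 "\<lambda>_. mat 1 :: real^'n^'n"]
    by (simp add: mexp_def sums_iff)
qed

lemma mexp_commute: "A ** mexp (t *\<^sub>R A) = mexp (t *\<^sub>R A) ** A"
proof -
  have "(\<lambda>k. A ** ((1 / fact k) *\<^sub>R matpow (t *\<^sub>R A) k)) sums (A ** mexp (t *\<^sub>R A))"
    by (intro bounded_linear.sums [OF mmult.bounded_linear_right] mexp_sums)
  moreover have "(\<lambda>k. ((1 / fact k) *\<^sub>R matpow (t *\<^sub>R A) k) ** A) sums (mexp (t *\<^sub>R A) ** A)"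
    by (intro bounded_linear.sums [OF mmult.bounded_linear_left] mexp_sums)
  moreover have "A ** ((1 / fact k) *\<^sub>R matpow (t *\<^sub>R A) k) = ((1 / fact k) *\<^sub>R matpow (t *\<^sub>R A) k) ** A"
    for k
    by (simp add: matpow_scaleR mmult.scaleR_left mmult.scaleR_right matpow_commute)
  ultimately show ?thesis
    by (simp add: sums_unique2)
qed

lemma mexp_transpose: "mexp (transpose A) = transpose (mexp A)"
proof -
  have "(\<lambda>k. transpose ((1 / fact k) *\<^sub>R matpow A k)) sums transpose (mexp A)"
    by (intro bounded_linear.sums [OF bounded_linear_transpose] mexp_sums)
  then have "(\<lambda>k. (1 / fact k) *\<^sub>R matpow (transpose A) k) sums transpose (mexp A)"
    by (simp add: transpose_scalar matpow_transpose)
  then show ?thesis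
    using mexp_sums sums_unique2 by blast
qed

text \<open>Each entry is an everywhere convergent real power series in t, so scalar termwise
  differentiation applies. On the coefficients, formal differentiation is left multiplication by
  A.\<close>

lemma mexp_has_vector_derivative:
  fixes A :: "real^'n^'n"
  shows "((\<lambda>t. mexp (t *\<^sub>R A)) has_vector_derivative A ** mexp (t *\<^sub>R A)) (at t within S)"
proof -
  define c where "c i j k = matpow A k $ i $ j / fact k" for i j k
  have entry_sums: "(\<lambda>k. c i j k * s ^ k) sums (mexp (s *\<^sub>R A) $ i $ j)" for i j s
    using bounded_linear.sums [OF bounded_linear_compose
        [OF bounded_linear_vec_nth bounded_linear_vec_nth] mexp_sums [of "s *\<^sub>R A"], of i j]
    by (simp add: c_def matpow_scaleR mult.commute)
  have diffs_entry: "diffs (c i j) k = (\<Sum>l\<in>UNIV. A $ i $ l * c l j k)" for i j k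
    by (simp add: diffs_def c_def matpow_Suc matrix_matrix_mult_def sum_divide_distrib
        sum_distrib_left divide_simps)
  have entry: "((\<lambda>t. mexp (t *\<^sub>R A) $ i $ j) has_field_derivative (A ** mexp (t *\<^sub>R A)) $ i $ j)
      (at t within S)" for i j
  proof -
    have "((\<lambda>t. \<Sum>k. c i j k * t ^ k) has_field_derivative (\<Sum>k. diffs (c i j) k * t ^ k)) (at t)"
      by (rule termdiffs_strong_converges_everywhere) (use entry_sums in \<open>auto simp: sums_iff\<close>)
    moreover have "(\<lambda>k. diffs (c i j) k * t ^ k) sums ((A ** mexp (t *\<^sub>R A)) $ i $ j)"
      unfolding diffs_entry matrix_matrix_mult_def sum_distrib_right
      using entry_sums by (auto intro!: sums_sum sums_mult simp: mult.assoc)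
    ultimately show ?thesis
      using entry_sums by (simp add: sums_iff has_field_derivative_at_within)
  qed
  show ?thesis
    unfolding has_vector_derivative_def
  proof (subst has_derivative_componentwise_within, safe)
    fix b :: "real^'n^'n"
    assume "b \<in> Basis"
    then obtain i j where b: "b = axis i (axis j 1)"
      by (auto simp: Basis_vec_def)
    show "((\<lambda>t. mexp (t *\<^sub>R A) \<bullet> b) has_derivative (\<lambda>x. (x *\<^sub>R (A ** mexp (t *\<^sub>R A))) \<bullet> b))
        (at t within S)"
      using entry [of i j]
      by (simp add: b inner_axis has_field_derivative_def mult_commute_abs)
  qed
qed

lemma continuous_on_mexp:
  "continuous_on S f \<Longrightarrow> continuous_on S (\<lambda>x. mexp (f x *\<^sub>R A))"
proof -
  have "continuous_on UNIV (\<lambda>t. mexp (t *\<^sub>R A))"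
    using has_vector_derivative_continuous [OF mexp_has_vector_derivative]
    by (auto simp: continuous_on_eq_continuous_within)
  then show "continuous_on S f \<Longrightarrow> continuous_on S (\<lambda>x. mexp (f x *\<^sub>R A))"
    by (rule continuous_on_compose2) auto
qed

lemma borel_measurable_mexp [measurable]:
  "(\<lambda>t. mexp (t *\<^sub>R A)) \<in> borel_measurable borel"
  by (intro borel_measurable_continuous_onI continuous_on_mexp continuous_on_id)

text \<open>F interpolates between the two sides: \<open>F 0\<close> is the left one and
  \<open>F t\<close> the right one. Its derivative vanishes because A commutes with its own
  exponential.\<close>

lemma mexp_add: "mexp ((s + t) *\<^sub>R A) = mexp (s *\<^sub>R A) ** mexp (t *\<^sub>R A)"
proof -
  define F where "F u = mexp ((s + t - u) *\<^sub>R A) ** mexp (u *\<^sub>R A)" for u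
  have deriv: "((\<lambda>u. mexp ((s + t - u) *\<^sub>R A)) has_vector_derivative
      (-1) *\<^sub>R (A ** mexp ((s + t - u) *\<^sub>R A))) (at u)" for u
    by (rule vector_diff_chain_at [of "\<lambda>u. s + t - u" "-1" u "\<lambda>t. mexp (t *\<^sub>R A)",
        OF _ mexp_has_vector_derivative, unfolded o_def])
      (auto intro!: derivative_eq_intros)
  have "(F has_vector_derivative 0) (at u)" for u
    unfolding F_def
    by (rule has_vector_derivative_eq_rhs
        [OF mmult.has_vector_derivative [OF deriv mexp_has_vector_derivative]])
      (simp add: matrix_mul_assoc mmult.minus_left flip: mexp_commute)
  then have "F t = F 0"
    using has_vector_derivative_zero_constant [of UNIV F]
    by (metis convex_UNIV UNIV_I)
  then show ?thesis by (simp add: F_def)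
qed

section \<open>Exponential decay of the matrix exponential\<close>

abbreviation cmat :: "real^'n^'m \<Rightarrow> complex^'n^'m" where
  "cmat \<equiv> map_matrix complex_of_real"

lemma cmat_mult: "cmat (A ** B) = cmat A ** cmat B"
  by (simp add: vec_eq_iff matrix_matrix_mult_def map_matrix_def)

lemma cmat_1: "cmat (mat 1 :: real^'n^'n) = mat 1"
  by (simp add: vec_eq_iff mat_def map_matrix_def)

lemma cmat_0_vector [simp]: "cmat 0 *v y = 0"
  by (simp add: vec_eq_iff matrix_vector_mult_def map_matrix_def)

lemma cmat_add_vector: "cmat (A + B) *v y = cmat A *v y + cmat B *v y"
  by (simp add: vec_eq_iff matrix_vector_mult_def map_matrix_def distrib_right sum.distrib)

lemma cmat_scaleR_vector: "cmat (c *\<^sub>R A) *v y = complex_of_real c *s (cmat A *v y)"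
  by (simp add: vec_eq_iff matrix_vector_mult_def map_matrix_def sum_distrib_left mult.assoc)

lemma cmat_sum_vector: "cmat (\<Sum>k\<in>K. F k) *v y = (\<Sum>k\<in>K. cmat (F k) *v y)"
  by (induction K rule: infinite_finite_induct) (simp_all add: cmat_add_vector)

text \<open>The product of the commuting factors A - r, applied to a vector. Removing the head of
  the list replaces y by (A - r) y, which is exactly the passage from one trajectory to the next in
  the decay estimate.\<close>

primrec shift_prod :: "complex^'n^'n \<Rightarrow> complex list \<Rightarrow> complex^'n \<Rightarrow> complex^'n" where
  "shift_prod A [] y = y"
| "shift_prod A (r # rs) y = shift_prod A rs (A *v y - r *s y)"

lemma shift_prod_shift:
  "shift_prod A rs (A *v y - r *s y) = A *v shift_prod A rs y - r *s shift_prod A rs y"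
proof (induction rs arbitrary: y)
  case (Cons q rs)
  have eq: "A *v (A *v y - r *s y) - q *s (A *v y - r *s y) =
      A *v (A *v y - q *s y) - r *s (A *v y - q *s y)"
    by (simp add: matrix_vector_mult_diff_distrib vector_scalar_commute vec_eq_iff algebra_simps)
  show ?case unfolding shift_prod.simps eq by (rule Cons.IH)
qed simp

text \<open>Shifts \<open>A - r\<close> with \<open>r\<close> not an eigenvalue are injective, so they can be cancelled.\<close>

lemma shift_prod_filter_eigenvalues:
  assumes "shift_prod (cmat A) rs y = 0"
  shows "shift_prod (cmat A) (filter (eigenvalue_of A) rs) y = 0"
  using assms
proof (induction rs arbitrary: y)
  case (Cons r rs)
  show ?case
  proof (cases "eigenvalue_of A r")
    case False
    \<comment> \<open>The head shift is moved to the outermost position, so the remaining product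
      would be an eigenvector for r if it were nonzero.\<close>
    have "cmat A *v shift_prod (cmat A) rs y = r *s shift_prod (cmat A) rs y"
      using Cons.prems by (simp add: shift_prod_shift)
    then have "shift_prod (cmat A) rs y = 0"
      using False unfolding eigenvalue_of_def by blast
    then show ?thesis using Cons.IH False by simp
  qed (use Cons in simp)
qed simp

section \<open>Polynomials in a matrix, acting on vectors\<close>

definition poly_act :: "complex^'n^'n \<Rightarrow> complex poly \<Rightarrow> complex^'n \<Rightarrow> complex^'n" where
  "poly_act A p y = (\<Sum>k\<le>degree p. coeff p k *s (((*v) A ^^ k) y))"

text \<open>Horner's rule. It frees the later arguments from \<open>degree\<close>, so that they run
  by induction on \<open>pCons\<close>.\<close>

lemma poly_act_pCons: "poly_act A (pCons c p) y = c *s y + poly_act A p (A *v y)"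
proof (cases "p = 0")
  case True
  then show ?thesis by (simp add: poly_act_def)
next
  case False
  then show ?thesis
    by (simp add: poly_act_def sum.atMost_Suc_shift funpow_swap1 del: sum.atMost_Suc)
qed

lemma poly_act_0 [simp]: "poly_act A 0 y = 0"
  by (simp add: poly_act_def)

lemma poly_act_add: "poly_act A (p + q) y = poly_act A p y + poly_act A q y"
  by (induction p q arbitrary: y rule: poly_induct2)
    (simp_all add: poly_act_pCons vec_eq_iff algebra_simps)

lemma poly_act_smult: "poly_act A (smult c p) y = c *s poly_act A p y"
  by (induction p arbitrary: y) (simp_all add: poly_act_pCons vec_eq_iff algebra_simps)

lemma poly_act_commute: "poly_act A p (A *v y) = A *v poly_act A p y"
  by (induction p arbitrary: y)
    (simp_all add: poly_act_pCons vector_scalar_commute matrix_vector_right_distrib)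

lemma poly_act_linear_factor:
  "poly_act A ([:-r, 1:] * p) y = A *v poly_act A p y - r *s poly_act A p y"
proof -
  have "[:-r, 1:] * p = smult (-r) p + pCons 0 p"
    by simp
  then show ?thesis
    by (simp only: poly_act_add poly_act_smult poly_act_pCons poly_act_commute)
      (simp add: vec_eq_iff)
qed

lemma poly_act_prod_list:
  "poly_act A (\<Prod>r\<leftarrow>rs. [:-r, 1:]) y = shift_prod A rs y"
  by (induction rs arbitrary: y)
    (simp_all only: list.map prod_list.Nil prod_list.Cons poly_act_linear_factor shift_prod.simps
      shift_prod_shift, simp add: poly_act_def)

text \<open>The powers up to the dimension N of the space of matrices are N + 1 in number, hence
  satisfy a nontrivial linear relation. Read as a polynomial, it factors over the complex numbers,
  and its roots form the list.\<close>

lemma exists_annihilating_shifts: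
  fixes A :: "real^'n^'n"
  shows "\<exists>rs. \<forall>y. shift_prod (cmat A) rs y = 0"
proof -
  define N where "N = DIM(real^'n^'n)"
  have "\<exists>u. (\<exists>k\<le>N. u k \<noteq> 0) \<and> (\<Sum>k\<le>N. u k *\<^sub>R matpow A k) = 0"
  proof (cases "inj_on (matpow A) {..N}")
    case True
    then have "dependent (matpow A ` {..N})"
      by (intro dependent_biggerset) (simp_all only: card_image N_def finite_imageI
        finite_atMost card_atMost lessI)
    then obtain w where w: "(\<Sum>X\<in>matpow A ` {..N}. w X *\<^sub>R X) = 0" "\<exists>X\<in>matpow A ` {..N}. w X \<noteq> 0"
      using dependent_finite [of "matpow A ` {..N}"] by auto
    then show ?thesis
      by (intro exI [of _ "\<lambda>k. w (matpow A k)"]) (simp add: sum.reindex [OF True] Bex_def)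
  next
    \<comment> \<open>Linear dependence speaks of a set, in which coinciding powers are merged. Here
      two equal powers give the relation directly, with coefficients 1 and -1.\<close>
    case False
    then obtain i j where ij: "i \<le> N" "j \<le> N" "i \<noteq> j" "matpow A i = matpow A j"
      by (auto simp: inj_on_def)
    let ?u = "\<lambda>k. if k = i then 1 else if k = j then -1 else 0 :: real"
    have "(\<Sum>k\<le>N. ?u k *\<^sub>R matpow A k) =
        (\<Sum>k\<le>N. (if k = i then matpow A i else 0) - (if k = j then matpow A j else 0))"
      using ij by (intro sum.cong) auto
    also have "\<dots> = 0"
      using ij by (simp add: sum_subtractf)
    finally show ?thesis
      using ij by (intro exI [of _ ?u]) auto
  qed
  then obtain u where u: "\<exists>k\<le>N. u k \<noteq> 0" "(\<Sum>k\<le>N. u k *\<^sub>R matpow A k) = 0"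
    by blast
  define p where "p = (\<Sum>k\<le>N. monom (complex_of_real (u k)) k)"
  have coeff_p: "coeff p k = (if k \<le> N then complex_of_real (u k) else 0)" for k
    by (simp add: p_def coeff_sum)
  then have "p \<noteq> 0"
    using u(1) by (metis coeff_0 of_real_eq_0_iff)
  obtain R where R: "size R = degree p \<and> p = smult (lead_coeff p) (\<Prod>x\<in>#R. [:-x, 1:])"
    using alg_closed_imp_factorization [OF \<open>p \<noteq> 0\<close>] ..
  obtain rs where rs: "mset rs = R"
    using ex_mset by blast
  have pow: "((*v) (cmat A) ^^ k) y = cmat (matpow A k) *v y" for k y
    by (induction k) (simp_all add: cmat_1 matpow_Suc cmat_mult matrix_vector_mul_assoc)
  \<comment> \<open>The top coefficients of the relation may vanish, so the degree can lie below N.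
    The sum in \<open>poly_act\<close> is then padded with zero terms.\<close>
  have "degree p \<le> N"
    by (rule degree_le) (simp add: coeff_p)
  have annihilates: "poly_act (cmat A) p y = 0" for y
  proof -
    have "poly_act (cmat A) p y = (\<Sum>k\<le>N. coeff p k *s (((*v) (cmat A) ^^ k) y))"
      unfolding poly_act_def
      using \<open>degree p \<le> N\<close> by (intro sum.mono_neutral_left) (auto simp: coeff_eq_0)
    also have "\<dots> = cmat (\<Sum>k\<le>N. u k *\<^sub>R matpow A k) *v y"
      by (simp add: coeff_p pow cmat_sum_vector cmat_scaleR_vector)
    finally show ?thesis
      by (simp only: u(2) cmat_0_vector)
  qed
  have p_prod: "p = smult (lead_coeff p) (\<Prod>r\<leftarrow>rs. [:-r, 1:])"
    using R [THEN conjunct2] by (metis rs mset_map prod_mset_prod_list)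
  have "lead_coeff p *s shift_prod (cmat A) rs y = 0" for y
    using annihilates [of y] by (subst (asm) p_prod) (simp only: poly_act_smult poly_act_prod_list)
  then show ?thesis
    using \<open>p \<noteq> 0\<close> by (auto simp: vec_eq_iff)
qed

lemma norm_vector_smult: "norm (c *s x) = cmod c * norm x" for x :: "complex^'n"
  by (simp add: norm_vec_def norm_mult L2_set_right_distrib)

lemma bounded_bilinear_vector_smult: "bounded_bilinear ((*s) :: complex \<Rightarrow> complex^'n \<Rightarrow> complex^'n)"
  by (rule bounded_bilinear.intro)
    (auto simp: vec_eq_iff algebra_simps norm_vector_smult intro!: exI [of _ 1])

text \<open>Peeling off one factor: \<open>e\<^bsup>-rt\<^esup> y(t)\<close> has derivative \<open>e\<^bsup>-rt\<^esup> (A - r) y(t)\<close>, and \<open>(A - r) y\<close> is again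
  a trajectory of the same equation, annihilated by the remaining factors.\<close>

lemma shift_prod_trajectory_decay:
  fixes C :: "complex^'n^'n" and y :: "real \<Rightarrow> complex^'n"
  assumes "\<And>r. r \<in> set rs \<Longrightarrow> Re r < - l"
    and "\<And>t. (y has_vector_derivative C *v y t) (at t)"
    and "\<And>t. shift_prod C rs (y t) = 0"
  shows "\<exists>K. \<forall>t\<ge>0. norm (y t) \<le> K * exp (- l * t)"
  using assms
proof (induction rs arbitrary: y)
  case Nil
  then show ?case by (auto intro!: exI [of _ 0])
next
  case (Cons r rs)
  define g where "g t = C *v y t - r *s y t" for t
  have bl: "bounded_linear (\<lambda>x. C *v x - r *s x)"
    by (intro bounded_linear_sub matrix_vector_mul_bounded_linear
        bounded_bilinear.bounded_linear_right [OF bounded_bilinear_vector_smult])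
  have "(g has_vector_derivative C *v g t) (at t)" for t
  proof -
    have "(g has_vector_derivative C *v (C *v y t) - r *s (C *v y t)) (at t)"
      unfolding g_def by (rule bounded_linear.has_vector_derivative [OF bl Cons.prems(2)])
    then show ?thesis
      by (simp add: g_def matrix_vector_mult_diff_distrib vector_scalar_commute)
  qed
  moreover have "shift_prod C rs (g t) = 0" for t
    using Cons.prems(3) by (simp add: g_def)
  ultimately obtain K where K: "\<And>t. t \<ge> 0 \<Longrightarrow> norm (g t) \<le> K * exp (- l * t)"
    using Cons.IH [of g] Cons.prems(1) by auto
  have "K \<ge> 0"
    using order_trans [OF norm_ge_zero K [of 0]] by simp
  \<comment> \<open>After multiplication by the exponential of -rt, the decay of g at rate l becomes
    growth at rate c. The strict inequality between Re r and -l makes c positive, so integrating the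
    bound K exp(c s) only costs the factor 1/c and no power of t.\<close>
  define c where "c = - Re r - l"
  have "c > 0"
    using Cons.prems(1) [of r] by (simp add: c_def)
  define h where "h t = exp (complex_of_real t * - r) *s y t" for t
  have "((\<lambda>t. exp (complex_of_real t * - r)) has_vector_derivative
      - r * exp (complex_of_real t * - r)) (at t)" for t
    using exp_scaleR_has_vector_derivative_right [of "- r" t UNIV]
    by (simp add: scaleR_conv_of_real mult.commute)
  then have "(h has_vector_derivative exp (complex_of_real t * - r) *s (C *v y t) +
      (- r * exp (complex_of_real t * - r)) *s y t) (at t)" for t
    unfolding h_def
    by (intro bounded_bilinear.has_vector_derivative [OF bounded_bilinear_vector_smult]
        Cons.prems(2))
  then have h': "(h has_vector_derivative exp (complex_of_real t * - r) *s g t) (at t)" for t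
    by (rule has_vector_derivative_eq_rhs) (simp add: g_def vec_eq_iff algebra_simps)
  have "norm (y t) \<le> (norm (y 0) + K / c) * exp (- l * t)" if "t \<ge> 0" for t
  proof -
    have "norm (h t - h 0) \<le> K / c * exp (c * t) - K / c * exp (c * 0)"
    \<comment> \<open>The mean value inequality, with majorant K/c exp(c s), requires a
      nondegenerate interval.\<close>
    proof (cases "t = 0")
      case False
      show ?thesis
      proof (rule differentiable_bound_general [OF _ _ _ h'])
        show "continuous_on {0..t} h"
          using has_vector_derivative_continuous [OF h']
          by (auto simp: continuous_on_eq_continuous_within intro: continuous_at_imp_continuous_within)
        show "((\<lambda>s. K / c * exp (c * s)) has_vector_derivative K * exp (c * s)) (at s)" for s
          using \<open>c > 0\<close>
          by (auto intro!: derivative_eq_intros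
              simp flip: has_real_derivative_iff_has_vector_derivative)
        show "norm (exp (complex_of_real s * - r) *s g s) \<le> K * exp (c * s)" if "0 < s" for s
        proof -
          have "norm (exp (complex_of_real s * - r) *s g s) \<le> exp (- Re r * s) * (K * exp (- l * s))"
            using K [of s] that by (simp add: norm_vector_smult mult.commute)
          also have "\<dots> = K * exp (c * s)"
            by (simp add: c_def algebra_simps flip: exp_add)
          finally show ?thesis .
        qed
        show "continuous_on {0..t} (\<lambda>s. K / c * exp (c * s))"
          by (intro continuous_on_mult_left continuous_on_exp continuous_on_id)
      qed (use False that in auto)
    qed simp
    moreover have "norm (h t) \<le> norm (h t - h 0) + norm (h 0)"
      by (metis diff_add_cancel norm_triangle_ineq)
    moreover have "norm (h 0) = norm (y 0)"
      by (simp add: h_def)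
    ultimately have "norm (h t) \<le> K / c * exp (c * t) + norm (y 0)"
      using \<open>K \<ge> 0\<close> \<open>c > 0\<close> by (smt (verit) divide_nonneg_pos exp_ge_zero mult_nonneg_nonneg)
    also have "\<dots> \<le> K / c * exp (c * t) + norm (y 0) * exp (c * t)"
      using \<open>c > 0\<close> that by (simp add: mult_le_cancel_left1)
    finally have "norm (h t) \<le> (norm (y 0) + K / c) * exp (c * t)"
      by (simp add: algebra_simps)
    moreover have "norm (y t) = exp (Re r * t) * norm (h t)"
    proof -
      have "norm (h t) = exp (- (Re r * t)) * norm (y t)"
        by (simp add: h_def norm_vector_smult mult.commute [of t])
      then show ?thesis by (simp add: exp_minus field_simps)
    qed
    ultimately have "norm (y t) \<le> exp (Re r * t) * ((norm (y 0) + K / c) * exp (c * t))"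
      by simp
    also have "\<dots> = (norm (y 0) + K / c) * exp (- l * t)"
      by (simp add: c_def algebra_simps flip: exp_add)
    finally show ?thesis .
  qed
  then show ?case by blast
qed

lemma mexp_exponential_decay:
  fixes A :: "real^'n^'n"
  assumes "\<And>\<mu>. eigenvalue_of A \<mu> \<Longrightarrow> Re \<mu> < 0"
  shows "\<exists>K l. l > 0 \<and> (\<forall>t\<ge>0. norm (mexp (t *\<^sub>R A)) \<le> K * exp (- l * t))"
proof -
  obtain qs where "\<And>y. shift_prod (cmat A) qs y = 0"
    using exists_annihilating_shifts by blast
  define rs where "rs = filter (eigenvalue_of A) qs"
  have rs: "\<And>y. shift_prod (cmat A) rs y = 0" "\<And>r. r \<in> set rs \<Longrightarrow> eigenvalue_of A r"
    unfolding rs_def using \<open>\<And>y. shift_prod (cmat A) qs y = 0\<close>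
    by (auto intro: shift_prod_filter_eigenvalues)
  \<comment> \<open>The distance from the imaginary axis to the eigenvalues in the list. The
    inserted 1 gives the minimum a value when the list is empty, and halving m leaves the strict
    margin that the trajectory estimate needs.\<close>
  define m where "m = Min (insert 1 ((\<lambda>r. - Re r) ` set rs))"
  define l where "l = m / 2"
  have "m > 0"
    unfolding m_def using rs(2) assms by (subst Min_gr_iff) auto
  then have "l > 0" "l < m"
    by (simp_all add: l_def)
  have Re_less: "Re r < - l" if "r \<in> set rs" for r
  proof -
    have "m \<le> - Re r"
      unfolding m_def using that by (intro Min_le) auto
    then show ?thesis using \<open>l < m\<close> by simp
  qed
  have "\<exists>K. \<forall>t\<ge>0. norm (cmat (mexp (t *\<^sub>R A)) *v u) \<le> K * exp (- l * t)" for u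
  proof (rule shift_prod_trajectory_decay)
    have "linear (\<lambda>X :: real^'n^'n. cmat X *v u)"
      by (intro linearI)
        (simp_all only: cmat_add_vector cmat_scaleR_vector, simp_all add: vec_eq_iff scaleR_conv_of_real [where 'a = complex])
    then have "bounded_linear (\<lambda>X :: real^'n^'n. cmat X *v u)"
      by (simp add: linear_conv_bounded_linear)
    from bounded_linear.has_vector_derivative [OF this mexp_has_vector_derivative]
    show "((\<lambda>t. cmat (mexp (t *\<^sub>R A)) *v u) has_vector_derivative
        cmat A *v (cmat (mexp (t *\<^sub>R A)) *v u)) (at t)" for t
      by (simp add: cmat_mult matrix_vector_mul_assoc)
  qed (use rs Re_less in auto)
  then obtain K where K: "\<And>u t. t \<ge> 0 \<Longrightarrow> norm (cmat (mexp (t *\<^sub>R A)) *v u) \<le> K u * exp (- l * t)"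
    by metis
  \<comment> \<open>Unit vectors as initial values give the columns of the exponential. The norm of
    the matrix is at most the sum of the absolute values of its entries.\<close>
  have "norm (mexp (t *\<^sub>R A)) \<le> (\<Sum>i\<in>(UNIV :: 'n set). \<Sum>j\<in>UNIV. K (axis j 1)) * exp (- l * t)"
    if "t \<ge> 0" for t
  proof -
    have "\<bar>mexp (t *\<^sub>R A) $ i $ j\<bar> \<le> K (axis j 1) * exp (- l * t)" for i j
    proof -
      have "\<bar>mexp (t *\<^sub>R A) $ i $ j\<bar> = cmod ((cmat (mexp (t *\<^sub>R A)) *v axis j 1) $ i)"
        by (simp add: matrix_vector_mult_def map_matrix_def axis_def if_distrib [of "(*) _"]
            cong: if_cong)
      also have "\<dots> \<le> norm (cmat (mexp (t *\<^sub>R A)) *v axis j 1)"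
        by (rule Finite_Cartesian_Product.norm_nth_le)
      finally show ?thesis using K [OF that] by (rule order_trans)
    qed
    then have "(\<Sum>i\<in>UNIV. \<Sum>j\<in>UNIV. \<bar>mexp (t *\<^sub>R A) $ i $ j\<bar>) \<le>
        (\<Sum>i\<in>(UNIV :: 'n set). \<Sum>j\<in>UNIV. K (axis j 1) * exp (- l * t))"
      by (intro sum_mono)
    moreover have "norm (mexp (t *\<^sub>R A)) \<le> (\<Sum>i\<in>UNIV. norm (mexp (t *\<^sub>R A) $ i))"
      unfolding norm_vec_def [of "mexp (t *\<^sub>R A)"] by (rule L2_set_le_sum) simp
    moreover have "\<dots> \<le> (\<Sum>i\<in>UNIV. \<Sum>j\<in>UNIV. \<bar>mexp (t *\<^sub>R A) $ i $ j\<bar>)"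
      by (intro sum_mono norm_le_l1_cart)
    ultimately show ?thesis
      unfolding sum_distrib_right by linarith
  qed
  with \<open>l > 0\<close> show ?thesis by blast
qed

section \<open>Limits of inner products in the mean square\<close>

text \<open>Continuity of the inner product of L2, in a form that serves both sides of the isometry:
  random scalars on the probability space and vector-valued integrands on the line. Convergence is
  stated with nonnegative integrals, as in \<open>has_wiener_integral\<close>, so square
  integrability of the limits is a result of the proof.\<close>

lemma inner_L2_approx_tendsto:
  fixes F G :: "nat \<Rightarrow> 'a \<Rightarrow> 'b::euclidean_space"
  assumes [measurable]: "\<And>j. F j \<in> borel_measurable M" "\<And>j. G j \<in> borel_measurable M"
    "f \<in> borel_measurable M" "g \<in> borel_measurable M"
    and F2: "\<And>j. integrable M (\<lambda>x. (norm (F j x))\<^sup>2)" and G2: "\<And>j. integrable M (\<lambda>x. (norm (G j x))\<^sup>2)"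
    and Ff: "(\<lambda>j. \<integral>\<^sup>+x. ennreal ((norm (f x - F j x))\<^sup>2) \<partial>M) \<longlonglongrightarrow> 0"
    and Gg: "(\<lambda>j. \<integral>\<^sup>+x. ennreal ((norm (g x - G j x))\<^sup>2) \<partial>M) \<longlonglongrightarrow> 0"
  shows "(\<lambda>j. \<integral>x. F j x \<bullet> G j x \<partial>M) \<longlonglongrightarrow> (\<integral>x. f x \<bullet> g x \<partial>M)"
proof -
  have sq_le: "(norm (u + w))\<^sup>2 \<le> 2 * ((norm u)\<^sup>2 + (norm w)\<^sup>2)" for u w :: 'b
  proof -
    have "(norm (u + w))\<^sup>2 + (norm (u - w))\<^sup>2 = 2 * ((norm u)\<^sup>2 + (norm w)\<^sup>2)"
      by (simp add: power2_norm_eq_inner inner_simps)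
    then show ?thesis using zero_le_power2 [of "norm (u - w)"] by linarith
  qed
  have limit: "integrable M (\<lambda>x. (norm (h x))\<^sup>2) \<and>
      (\<forall>\<^sub>F j in sequentially. integrable M (\<lambda>x. (norm (h x - H j x))\<^sup>2)) \<and>
      (\<lambda>j. \<integral>x. (norm (h x - H j x))\<^sup>2 \<partial>M) \<longlonglongrightarrow> 0"
    if [measurable]: "\<And>j. H j \<in> borel_measurable M" "h \<in> borel_measurable M"
      and H2: "\<And>j. integrable M (\<lambda>x. (norm (H j x))\<^sup>2)"
      and Hh: "(\<lambda>j. \<integral>\<^sup>+x. ennreal ((norm (h x - H j x))\<^sup>2) \<partial>M) \<longlonglongrightarrow> 0"
    for H :: "nat \<Rightarrow> 'a \<Rightarrow> 'b" and h
  proof (intro conjI)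
    \<comment> \<open>Any finite bound would do. Convergence to 0 in the extended reals allows
      infinite values at first, so the differences are square integrable only eventually.\<close>
    have "\<forall>\<^sub>F j in sequentially. (\<integral>\<^sup>+x. ennreal ((norm (h x - H j x))\<^sup>2) \<partial>M) < 1"
      using Hh by (rule order_tendstoD) simp
    then show ev: "\<forall>\<^sub>F j in sequentially. integrable M (\<lambda>x. (norm (h x - H j x))\<^sup>2)"
      by eventually_elim (auto intro!: integrableI_bounded intro: less_le_trans [OF _ top_greatest])
    then obtain j where "integrable M (\<lambda>x. (norm (h x - H j x))\<^sup>2)"
      by (auto simp: eventually_sequentially)
    then have "integrable M (\<lambda>x. 2 * ((norm (h x - H j x))\<^sup>2 + (norm (H j x))\<^sup>2))"
      using H2 by auto
    then show "integrable M (\<lambda>x. (norm (h x))\<^sup>2)"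
      by (rule Bochner_Integration.integrable_bound)
        (use sq_le [of "h x - H j x" "H j x" for x] in auto)
    have "(\<lambda>j. enn2real (\<integral>\<^sup>+x. ennreal ((norm (h x - H j x))\<^sup>2) \<partial>M)) \<longlonglongrightarrow> enn2real 0"
      using Hh by (intro tendsto_enn2real) auto
    then show "(\<lambda>j. \<integral>x. (norm (h x - H j x))\<^sup>2 \<partial>M) \<longlonglongrightarrow> 0"
      by (simp add: integral_eq_nn_integral)
  qed
  from limit [OF _ _ F2 Ff] have
    f2: "integrable M (\<lambda>x. (norm (f x))\<^sup>2)"
    and evF: "\<forall>\<^sub>F j in sequentially. integrable M (\<lambda>x. (norm (f x - F j x))\<^sup>2)"
    and limF: "(\<lambda>j. \<integral>x. (norm (f x - F j x))\<^sup>2 \<partial>M) \<longlonglongrightarrow> 0"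
    by simp_all
  from limit [OF _ _ G2 Gg] have
    g2: "integrable M (\<lambda>x. (norm (g x))\<^sup>2)"
    and evG: "\<forall>\<^sub>F j in sequentially. integrable M (\<lambda>x. (norm (g x - G j x))\<^sup>2)"
    and limG: "(\<lambda>j. \<integral>x. (norm (g x - G j x))\<^sup>2 \<partial>M) \<longlonglongrightarrow> 0"
    by simp_all
  have young: "\<bar>u \<bullet> w\<bar> \<le> (norm u)\<^sup>2 + (norm w)\<^sup>2" for u w :: 'b
  proof -
    have "\<bar>u \<bullet> w\<bar> \<le> norm u * norm w"
      by (rule Cauchy_Schwarz_ineq2)
    also have "\<dots> \<le> (norm u)\<^sup>2 + (norm w)\<^sup>2"
      using sum_squares_bound [of "norm u" "norm w"]
        mult_nonneg_nonneg [OF norm_ge_zero [of u] norm_ge_zero [of w]]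
      by linarith
    finally show ?thesis .
  qed
  have int_inner: "integrable M (\<lambda>x. p x \<bullet> q x)"
    if "p \<in> borel_measurable M" "q \<in> borel_measurable M"
      "integrable M (\<lambda>x. (norm (p x))\<^sup>2)" "integrable M (\<lambda>x. (norm (q x))\<^sup>2)" for p q :: "'a \<Rightarrow> 'b"
    using that(1,2) young
    by (intro Bochner_Integration.integrable_bound [OF Bochner_Integration.integrable_add
          [OF that(3,4)]]) auto
  \<comment> \<open>Young's inequality with weight e, from rescaling the two vectors by reciprocal
    factors. It takes the place of the Cauchy-Schwarz inequality for integrals in the cross
    terms.\<close>
  have weighted: "\<bar>u \<bullet> w\<bar> \<le> e * (norm w)\<^sup>2 + (norm u)\<^sup>2 / e" if "e > 0" for u w :: 'b and e
  proof -
    have "(1 / sqrt e) *\<^sub>R u \<bullet> sqrt e *\<^sub>R w = u \<bullet> w"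
      using that by simp
    then show ?thesis
      using young [of "(1 / sqrt e) *\<^sub>R u" "sqrt e *\<^sub>R w"] that
      by (simp add: power_mult_distrib power_divide)
  qed
  show ?thesis
  proof (rule LIMSEQ_I, goal_cases)
    case (1 r)
    \<comment> \<open>D bounds the integrals of the squares of f and g, and e is chosen so that e *
      D = r / 2. The summand 1 keeps D positive when both integrals vanish.\<close>
    define D where "D = 1 + (\<integral>x. (norm (f x))\<^sup>2 \<partial>M) + (\<integral>x. (norm (g x))\<^sup>2 \<partial>M)"
    have "D > 0"
      unfolding D_def by (intro add_pos_nonneg) auto
    define e where "e = r / (2 * D)"
    have "e > 0"
      using \<open>r > 0\<close> \<open>D > 0\<close> by (simp add: e_def)
    have "(\<lambda>j. (1 + 1 / e) * (\<integral>x. (norm (f x - F j x))\<^sup>2 \<partial>M) +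
        (1 + 1 / e) * (\<integral>x. (norm (g x - G j x))\<^sup>2 \<partial>M)) \<longlonglongrightarrow> (1 + 1 / e) * 0 + (1 + 1 / e) * 0"
      by (intro tendsto_intros limF limG)
    then have "\<forall>\<^sub>F j in sequentially. (1 + 1 / e) * (\<integral>x. (norm (f x - F j x))\<^sup>2 \<partial>M) +
        (1 + 1 / e) * (\<integral>x. (norm (g x - G j x))\<^sup>2 \<partial>M) < r / 2"
      by (rule order_tendstoD) (use \<open>r > 0\<close> in simp)
    then have "\<forall>\<^sub>F j in sequentially. norm ((\<integral>x. F j x \<bullet> G j x \<partial>M) - (\<integral>x. f x \<bullet> g x \<partial>M)) < r"
      using evF evG
    proof eventually_elim
      case (elim j)
      have "norm ((\<integral>x. F j x \<bullet> G j x \<partial>M) - (\<integral>x. f x \<bullet> g x \<partial>M)) =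
          norm (\<integral>x. F j x \<bullet> G j x - f x \<bullet> g x \<partial>M)"
        using F2 G2 f2 g2 by (simp add: int_inner)
      also have "\<dots> \<le> (\<integral>x. norm (F j x \<bullet> G j x - f x \<bullet> g x) \<partial>M)"
        by (rule integral_norm_bound)
      also have "\<dots> \<le> (\<integral>x. (1 + 1 / e) * (norm (f x - F j x))\<^sup>2 +
          (1 + 1 / e) * (norm (g x - G j x))\<^sup>2 + (e * (norm (f x))\<^sup>2 + e * (norm (g x))\<^sup>2) \<partial>M)"
      proof (rule integral_mono)
        show "integrable M (\<lambda>x. norm (F j x \<bullet> G j x - f x \<bullet> g x))"
          using F2 G2 f2 g2 by (simp add: int_inner)
        show "integrable M (\<lambda>x. (1 + 1 / e) * (norm (f x - F j x))\<^sup>2 +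
            (1 + 1 / e) * (norm (g x - G j x))\<^sup>2 + (e * (norm (f x))\<^sup>2 + e * (norm (g x))\<^sup>2))"
          using elim f2 g2 by (intro Bochner_Integration.integrable_add integrable_mult_right) auto
        fix x
        \<comment> \<open>Every term on the right contains an error factor. The product of two
          errors is bounded by the plain inequality, the two mixed terms by the weighted
          one.\<close>
        have "F j x \<bullet> G j x - f x \<bullet> g x = (f x - F j x) \<bullet> (g x - G j x)
            - (f x - F j x) \<bullet> g x - (g x - G j x) \<bullet> f x"
          by (simp add: inner_simps inner_commute)
        then show "norm (F j x \<bullet> G j x - f x \<bullet> g x) \<le> (1 + 1 / e) * (norm (f x - F j x))\<^sup>2 +
            (1 + 1 / e) * (norm (g x - G j x))\<^sup>2 + (e * (norm (f x))\<^sup>2 + e * (norm (g x))\<^sup>2)"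
          using young [of "f x - F j x" "g x - G j x"]
            weighted [OF \<open>e > 0\<close>, of "f x - F j x" "g x"]
            weighted [OF \<open>e > 0\<close>, of "g x - G j x" "f x"]
          by (simp add: algebra_simps)
      qed
      also have "\<dots> = (1 + 1 / e) * (\<integral>x. (norm (f x - F j x))\<^sup>2 \<partial>M) +
          (1 + 1 / e) * (\<integral>x. (norm (g x - G j x))\<^sup>2 \<partial>M) +
          (e * (\<integral>x. (norm (f x))\<^sup>2 \<partial>M) + e * (\<integral>x. (norm (g x))\<^sup>2 \<partial>M))"
        using elim f2 g2 by simp
      also have "\<dots> < r / 2 + e * D"
        using elim(1) \<open>e > 0\<close> by (simp add: D_def algebra_simps)
      also have "\<dots> = r"
        using \<open>D > 0\<close> by (simp add: e_def)
      finally show ?case .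
    qed
    then show ?case
      by (auto simp: eventually_sequentially)
  qed
qed

section \<open>The isometry of the Wiener integral\<close>

lemma brownian_motion_prob_space: "brownian_motion M W \<Longrightarrow> prob_space M"
  by (simp add: brownian_motion_def)

lemma brownian_motion_measurable: "brownian_motion M W \<Longrightarrow> W t \<in> borel_measurable M"
  by (simp add: brownian_motion_def)

lemma brownian_increment_moments:
  assumes "brownian_motion M W" and "s < t"
  shows "integrable M (\<lambda>x. (W t x - W s x) $ i)"
    and "integrable M (\<lambda>x. ((W t x - W s x) $ i)\<^sup>2)"
    and "(\<integral>x. (W t x - W s x) $ i \<partial>M) = 0"
    and "(\<integral>x. ((W t x - W s x) $ i)\<^sup>2 \<partial>M) = t - s"
proof -
  interpret prob_space M
    using assms(1) by (rule brownian_motion_prob_space)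
  have D: "distributed M lborel (\<lambda>x. (W t x - W s x) $ i)
      (\<lambda>y. ennreal (normal_density 0 (sqrt (t - s)) y))"
    using assms by (simp add: brownian_motion_def)
  have pos: "0 < sqrt (t - s)"
    using assms(2) by simp
  show "integrable M (\<lambda>x. (W t x - W s x) $ i)"
    using distributed_integrable [OF D, of "\<lambda>y. y"] integrable_normal_moment_nz_1 [OF pos, of 0]
    by simp
  show "integrable M (\<lambda>x. ((W t x - W s x) $ i)\<^sup>2)"
    using distributed_integrable [OF D, of "\<lambda>y. y\<^sup>2"] integrable_normal_moment [OF pos, of 0 2]
    by simp
  show mean: "(\<integral>x. (W t x - W s x) $ i \<partial>M) = 0"
    using normal_distributed_expectation [OF pos D] .
  show "(\<integral>x. ((W t x - W s x) $ i)\<^sup>2 \<partial>M) = t - s"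
    using normal_distributed_variance [OF pos D] assms(2) unfolding mean by simp
qed

lemma brownian_increments_product_integrable:
  assumes W: "brownian_motion M W" and "s < t" "u < w"
  shows "integrable M (\<lambda>x. (W t x - W s x) $ i * (W w x - W u x) $ k)"
proof (rule Bochner_Integration.integrable_bound)
  show "integrable M (\<lambda>x. ((W t x - W s x) $ i)\<^sup>2 + ((W w x - W u x) $ k)\<^sup>2)"
    using assms by (intro Bochner_Integration.integrable_add brownian_increment_moments)
  show "(\<lambda>x. (W t x - W s x) $ i * (W w x - W u x) $ k) \<in> borel_measurable M"
    using assms
    by (intro borel_measurable_times borel_measurable_integrable [OF brownian_increment_moments(1)])
  have "\<bar>a * b\<bar> \<le> a\<^sup>2 + b\<^sup>2" for a b :: real
    using sum_squares_bound [of "\<bar>a\<bar>" "\<bar>b\<bar>"] mult_nonneg_nonneg [OF abs_ge_zero [of a] abs_ge_zero [of b]]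
    by (simp only: abs_mult power2_abs)
  then show "AE x in M. norm ((W t x - W s x) $ i * (W w x - W u x) $ k) \<le>
      norm (((W t x - W s x) $ i)\<^sup>2 + ((W w x - W u x) $ k)\<^sup>2)"
    by simp
qed

lemma brownian_increment_components:
  assumes W: "brownian_motion M W" and "s < t"
  shows "(\<integral>x. (W t x - W s x) $ i * (W t x - W s x) $ k \<partial>M) = (if i = k then t - s else 0)"
proof (cases "i = k")
  case True
  then show ?thesis
    using brownian_increment_moments(4) [OF assms, of i] by (simp add: power2_eq_square)
next
  case False
  interpret prob_space M
    using W by (rule brownian_motion_prob_space)
  have "indep_vars (\<lambda>_. borel) (\<lambda>i x. (W t x - W s x) $ i) UNIV"
    using assms by (simp add: brownian_motion_def)
  then have "indep_vars (\<lambda>_. borel) (\<lambda>i x. (W t x - W s x) $ i) {i, k}"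
    by (rule indep_vars_subset) simp
  from indep_vars_lebesgue_integral [OF _ this]
  show ?thesis
    using False
    by (simp add: brownian_increment_moments [OF assms] del: vector_minus_component)
qed

lemma brownian_disjoint_increments:
  assumes W: "brownian_motion M W" and "s < t" "t < u"
  shows "(\<integral>x. (W t x - W s x) $ i * (W u x - W t x) $ k \<partial>M) = 0"
proof -
  interpret prob_space M
    using W by (rule brownian_motion_prob_space)
  \<comment> \<open>The three points as the beginning of a sequence, since independence of
    increments is stated for sequences of times. Only the two increments with index below 2 matter,
    so p may stay constant afterwards.\<close>
  define p where "p = (\<lambda>j :: nat. if j = 0 then s else if j = 1 then t else u)"
  have "\<forall>j<2. p j < p (Suc j)"
    using assms by (auto simp: p_def)
  then have "indep_vars (\<lambda>_. borel) (\<lambda>j x. W (p (Suc j)) x - W (p j) x) {..<2}"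
    using W unfolding brownian_motion_def by blast
  then have "indep_vars (\<lambda>_. borel)
      (\<lambda>j x. (W (p (Suc j)) x - W (p j) x) $ (if j = 0 then i else k)) {..<2}"
    by (rule indep_vars_compose2) simp
  moreover have "(\<integral>x. (W (p (Suc j)) x - W (p j) x) $ q \<partial>M) = 0"
    "integrable M (\<lambda>x. (W (p (Suc j)) x - W (p j) x) $ q)" if "j < 2" for j q
    using \<open>\<forall>j<2. p j < p (Suc j)\<close> that by (simp_all only: brownian_increment_moments [OF W])
  ultimately have "(\<integral>x. (\<Prod>j<(2 :: nat). (W (p (Suc j)) x - W (p j) x) $ (if j = 0 then i else k)) \<partial>M) =
      (\<Prod>j<(2 :: nat). 0 :: real)"
    by (subst indep_vars_lebesgue_integral) (auto simp del: vector_minus_component)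
  then show ?thesis
    by (simp add: p_def numeral_2_eq_2)
qed

text \<open>The usual covariance \<open>min s t\<close>, seen from a base point r: on the whole line
  no fixed origin lies to the left of all times. For s < t the later increment is split at s, and
  its second part is uncorrelated with the first.\<close>

lemma brownian_covariance:
  assumes W: "brownian_motion M W" and "r < s" "r < t"
  shows "(\<integral>x. (W s x - W r x) $ i * (W t x - W r x) $ k \<partial>M) = (if i = k then min s t - r else 0)"
proof -
  have le: "(\<integral>x. (W s x - W r x) $ i * (W t x - W r x) $ k \<partial>M) = (if i = k then s - r else 0)"
    if "r < s" "s \<le> t" for s t i k
  proof (cases "s = t")
    case True
    then show ?thesis using brownian_increment_components [OF W] that by simp
  next
    case False
    with that have "s < t" by simp
    have "(\<integral>x. (W s x - W r x) $ i * (W t x - W r x) $ k \<partial>M) =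
        (\<integral>x. (W s x - W r x) $ i * (W s x - W r x) $ k + (W s x - W r x) $ i * (W t x - W s x) $ k \<partial>M)"
      by (simp add: algebra_simps)
    also have "\<dots> = (\<integral>x. (W s x - W r x) $ i * (W s x - W r x) $ k \<partial>M) +
        (\<integral>x. (W s x - W r x) $ i * (W t x - W s x) $ k \<partial>M)"
      using that \<open>s < t\<close>
      by (intro Bochner_Integration.integral_add brownian_increments_product_integrable [OF W])
    also have "\<dots> = (if i = k then s - r else 0)"
      by (simp only: brownian_increment_components [OF W \<open>r < s\<close>]
          brownian_disjoint_increments [OF W \<open>r < s\<close> \<open>s < t\<close>] add_0_right)
    finally show ?thesis .
  qed
  show ?thesis
  proof (cases "s \<le> t")
    case True
    then show ?thesis using le [OF \<open>r < s\<close>, of t i k] by simp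
  next
    case False
    then show ?thesis using le [OF \<open>r < t\<close>, of s k i] by (simp add: mult.commute eq_commute)
  qed
qed

lemma brownian_increments_covariance:
  assumes W: "brownian_motion M W" and "a < b" "c < d"
  shows "(\<integral>x. (W b x - W a x) $ i * (W d x - W c x) $ k \<partial>M) =
    (if i = k then \<integral>s. indicator {a<..b} s * indicator {c<..d} s \<partial>lborel else 0)"
proof -
  \<comment> \<open>A base point strictly to the left of both intervals, so that all four endpoints
    give genuine increments from r. Expanding the product then needs only
    \<open>brownian_covariance\<close>, with no case distinction on how the intervals lie.\<close>
  define r where "r = min a c - 1"
  have r: "r < a" "r < b" "r < c" "r < d"
    using assms by (auto simp: r_def)
  let ?D = "\<lambda>t i x. (W t x - W r x) $ i"
  have int: "integrable M (\<lambda>x. ?D s i x * ?D t k x)" if "r < s" "r < t" for s t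
    using that by (intro brownian_increments_product_integrable [OF W])
  have "(\<integral>x. (W b x - W a x) $ i * (W d x - W c x) $ k \<partial>M) =
      (\<integral>x. (?D b i x * ?D d k x - ?D a i x * ?D d k x) - (?D b i x * ?D c k x - ?D a i x * ?D c k x) \<partial>M)"
    by (rule Bochner_Integration.integral_cong) (simp_all add: algebra_simps)
  also have "\<dots> = ((\<integral>x. ?D b i x * ?D d k x \<partial>M) - (\<integral>x. ?D a i x * ?D d k x \<partial>M)) -
      ((\<integral>x. ?D b i x * ?D c k x \<partial>M) - (\<integral>x. ?D a i x * ?D c k x \<partial>M))"
    using r by (simp only: int Bochner_Integration.integral_diff Bochner_Integration.integrable_diff)
  also have "\<dots> = (if i = k then min b d - min a d - (min b c - min a c) else 0)"
    using r by (simp only: brownian_covariance [OF W]) simp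
  \<comment> \<open>The alternating sum of minima is the length of the overlap, and it is 0 if the
    intervals do not meet.\<close>
  also have "min b d - min a d - (min b c - min a c) = measure lborel {max a c<..min b d}"
  proof (cases "max a c \<le> min b d")
    case True
    then have "measure lborel {max a c<..min b d} = min b d - max a c"
      by (rule measure_lborel_Ioc)
    then show ?thesis using True assms(2,3) by (simp add: min_def max_def split: if_splits)
  next
    case False
    then have "{max a c<..min b d} = {}"
      by (intro greaterThanAtMost_empty) linarith
    then have "measure lborel {max a c<..min b d} = 0"
      by (simp only: measure_empty)
    moreover have "b < c \<or> d < a"
      using False assms(2,3) by (auto simp: min_def max_def split: if_splits)
    then have "min b d - min a d - (min b c - min a c) = 0"
      using assms(2,3) by (auto simp: min_def)
    ultimately show ?thesis by simp
  qed
  also have "\<dots> = (\<integral>s. indicator {a<..b} s * indicator {c<..d} s \<partial>lborel)"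
  proof -
    have "{a<..b} \<inter> {c<..d} = {max a c<..min b d}"
      by auto
    then show ?thesis
      by (simp flip: indicator_inter_arith)
  qed
  finally show ?thesis .
qed

section \<open>Integrals of step functions\<close>

definition step_vec :: "nat \<Rightarrow> (nat \<Rightarrow> real) \<Rightarrow> (nat \<Rightarrow> real^'m) \<Rightarrow> real \<Rightarrow> real^'m" where
  "step_vec n t c s = (\<Sum>k<n. indicator {t k<..t (Suc k)} s *\<^sub>R c k)"

lemma transpose_step_fun:
  "transpose (step_fun n t C s) *v \<alpha> = step_vec n t (\<lambda>k. transpose (C k) *v \<alpha>) s"
  by (simp add: step_fun_def step_vec_def mvmult.sum_left transpose_scalar
      linear_sum [OF bounded_linear.linear [OF bounded_linear_transpose]] mvmult.scaleR_left)

lemma inner_step_integral: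
  "\<alpha> \<bullet> step_integral W n t C x =
    (\<Sum>k<n. (transpose (C k) *v \<alpha>) \<bullet> (W (t (Suc k)) x - W (t k) x))"
  by (simp add: step_integral_def inner_sum_right flip: dot_lmul_matrix)

lemma brownian_increments_inner_covariance:
  assumes W: "brownian_motion M W" and "a < b" "c < d"
  shows "integrable M (\<lambda>x. (p \<bullet> (W b x - W a x)) * (q \<bullet> (W d x - W c x)))"
    and "(\<integral>x. (p \<bullet> (W b x - W a x)) * (q \<bullet> (W d x - W c x)) \<partial>M) =
      (p \<bullet> q) * (\<integral>s. indicator {a<..b} s * indicator {c<..d} s \<partial>lborel)"
proof -
  have eq: "(p \<bullet> (W b x - W a x)) * (q \<bullet> (W d x - W c x)) =
      (\<Sum>i\<in>UNIV. \<Sum>k\<in>UNIV. (p $ i * q $ k) * ((W b x - W a x) $ i * (W d x - W c x) $ k))" for x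
    by (simp add: inner_vec_def sum_product mult_ac)
  note int = brownian_increments_product_integrable [OF W \<open>a < b\<close> \<open>c < d\<close>]
  show "integrable M (\<lambda>x. (p \<bullet> (W b x - W a x)) * (q \<bullet> (W d x - W c x)))"
    unfolding eq by (intro Bochner_Integration.integrable_sum integrable_mult_right int)
  define J :: real where "J = (\<integral>s. indicator {a<..b} s * indicator {c<..d} s \<partial>lborel)"
  have int': "integrable M (\<lambda>x. (p $ i * q $ k) * ((W b x - W a x) $ i * (W d x - W c x) $ k))" for i k
    by (intro integrable_mult_right int)
  have "(\<integral>x. (p \<bullet> (W b x - W a x)) * (q \<bullet> (W d x - W c x)) \<partial>M) =
      (\<Sum>i\<in>UNIV. \<Sum>k\<in>UNIV. \<integral>x. (p $ i * q $ k) * ((W b x - W a x) $ i * (W d x - W c x) $ k) \<partial>M)"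
    unfolding eq
    by (simp only: Bochner_Integration.integral_sum Bochner_Integration.integrable_sum int')
  also have "\<dots> = (\<Sum>i\<in>UNIV. \<Sum>k\<in>UNIV. (p $ i * q $ k) * (if i = k then J else 0))"
    by (simp only: integral_mult_right_zero brownian_increments_covariance [OF assms] J_def)
  also have "\<dots> = (p \<bullet> q) * J"
    by (simp add: inner_vec_def sum_distrib_right if_distrib cong: if_cong)
  finally show "(\<integral>x. (p \<bullet> (W b x - W a x)) * (q \<bullet> (W d x - W c x)) \<partial>M) =
      (p \<bullet> q) * (\<integral>s. indicator {a<..b} s * indicator {c<..d} s \<partial>lborel)"
    by (simp only: J_def)
qed

text \<open>Both sides expand into the same double sum over pairs of cells, in which each pair
  contributes the length of its overlap. Two partitions and two functionals are allowed because the
  integrals at two different times are later paired with each other. The integrability claims supply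
  the square integrability used in the limit.\<close>

lemma step_integral_isometry:
  assumes W: "brownian_motion M W"
    and t: "\<And>k. k < n \<Longrightarrow> t k < t (Suc k)" and t': "\<And>k. k < n' \<Longrightarrow> t' k < t' (Suc k)"
  shows "integrable M (\<lambda>x. (\<alpha> \<bullet> step_integral W n t C x) * (\<beta> \<bullet> step_integral W n' t' C' x))" (is ?intM)
    and "integrable lborel
      (\<lambda>s. (transpose (step_fun n t C s) *v \<alpha>) \<bullet> (transpose (step_fun n' t' C' s) *v \<beta>))" (is ?intL)
    and "(\<integral>x. (\<alpha> \<bullet> step_integral W n t C x) * (\<beta> \<bullet> step_integral W n' t' C' x) \<partial>M) =
      (\<integral>s. (transpose (step_fun n t C s) *v \<alpha>) \<bullet> (transpose (step_fun n' t' C' s) *v \<beta>) \<partial>lborel)"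
      (is ?isometry)
proof -
  define p where "p k = transpose (C k) *v \<alpha>" for k
  define q where "q k = transpose (C' k) *v \<beta>" for k
  define ind :: "nat \<Rightarrow> nat \<Rightarrow> real \<Rightarrow> real" where
    "ind k l s = indicator {t k<..t (Suc k)} s * indicator {t' l<..t' (Suc l)} s" for k l s
  have M_eq: "(\<alpha> \<bullet> step_integral W n t C x) * (\<beta> \<bullet> step_integral W n' t' C' x) =
      (\<Sum>k<n. \<Sum>l<n'. (p k \<bullet> (W (t (Suc k)) x - W (t k) x)) * (q l \<bullet> (W (t' (Suc l)) x - W (t' l) x)))" for x
    by (simp only: inner_step_integral sum_product p_def q_def)
  have L_eq: "(transpose (step_fun n t C s) *v \<alpha>) \<bullet> (transpose (step_fun n' t' C' s) *v \<beta>) =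
      (\<Sum>k<n. \<Sum>l<n'. (p k \<bullet> q l) * ind k l s)" for s
    unfolding transpose_step_fun step_vec_def inner_sum_left unfolding inner_sum_right p_def q_def ind_def
    by (simp only: inner_scaleR_left inner_scaleR_right mult_ac)
  have ind_int: "integrable lborel (ind k l)" if "k < n" for k l
  proof (rule Bochner_Integration.integrable_bound)
    show "integrable lborel (indicator {t k<..t (Suc k)} :: real \<Rightarrow> real)"
      using t [OF that] by simp
    show "AE s in lborel. norm (ind k l s) \<le> norm (indicator {t k<..t (Suc k)} s :: real)"
      by (simp add: ind_def indicator_def)
    show "ind k l \<in> borel_measurable lborel"
      unfolding ind_def [abs_def] by measurable
  qed
  note cov = brownian_increments_inner_covariance [OF W t t']
  show ?intM
    unfolding M_eq by (intro Bochner_Integration.integrable_sum cov(1)) auto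
  show ?intL
    unfolding L_eq by (intro Bochner_Integration.integrable_sum integrable_mult_right ind_int) auto
  have intM: "integrable M (\<lambda>x. (p k \<bullet> (W (t (Suc k)) x - W (t k) x)) *
      (q l \<bullet> (W (t' (Suc l)) x - W (t' l) x)))" if "k \<in> {..<n}" "l \<in> {..<n'}" for k l
    using that by (intro cov(1)) auto
  have intL: "integrable lborel (\<lambda>s. (p k \<bullet> q l) * ind k l s)" if "k \<in> {..<n}" for k l
    using that by (intro integrable_mult_right ind_int) auto
  have "(\<integral>x. (\<alpha> \<bullet> step_integral W n t C x) * (\<beta> \<bullet> step_integral W n' t' C' x) \<partial>M) =
      (\<Sum>k<n. \<integral>x. (\<Sum>l<n'. (p k \<bullet> (W (t (Suc k)) x - W (t k) x)) *
        (q l \<bullet> (W (t' (Suc l)) x - W (t' l) x))) \<partial>M)"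
    unfolding M_eq
    by (rule Bochner_Integration.integral_sum, rule Bochner_Integration.integrable_sum, rule intM)
  also have "\<dots> = (\<Sum>k<n. \<Sum>l<n'. \<integral>x. (p k \<bullet> (W (t (Suc k)) x - W (t k) x)) *
        (q l \<bullet> (W (t' (Suc l)) x - W (t' l) x)) \<partial>M)"
    by (intro sum.cong refl Bochner_Integration.integral_sum intM)
  also have "\<dots> = (\<Sum>k<n. \<Sum>l<n'. \<integral>s. (p k \<bullet> q l) * ind k l s \<partial>lborel)"
    unfolding integral_mult_right_zero ind_def
    by (intro sum.cong refl brownian_increments_inner_covariance(2) [OF W t t']) auto
  also have "\<dots> = (\<Sum>k<n. \<integral>s. (\<Sum>l<n'. (p k \<bullet> q l) * ind k l s) \<partial>lborel)"
    by (intro sum.cong refl Bochner_Integration.integral_sum [symmetric] intL)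
  also have "\<dots> = (\<integral>s. (\<Sum>k<n. \<Sum>l<n'. (p k \<bullet> q l) * ind k l s) \<partial>lborel)"
    by (rule Bochner_Integration.integral_sum [symmetric], rule Bochner_Integration.integrable_sum,
        rule intL)
  finally show ?isometry
    unfolding L_eq .
qed

section \<open>From step functions to general integrands\<close>

lemma L2_tendsto_bounded_image:
  fixes F :: "nat \<Rightarrow> 'a \<Rightarrow> 'b::real_normed_vector" and T :: "'b \<Rightarrow> 'c::real_normed_vector"
  assumes T: "bounded_linear T"
    and meas: "\<And>j. (\<lambda>x. ennreal ((norm (f x - F j x))\<^sup>2)) \<in> borel_measurable M"
    and lim: "(\<lambda>j. \<integral>\<^sup>+x. ennreal ((norm (f x - F j x))\<^sup>2) \<partial>M) \<longlonglongrightarrow> 0"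
  shows "(\<lambda>j. \<integral>\<^sup>+x. ennreal ((norm (T (f x) - T (F j x)))\<^sup>2) \<partial>M) \<longlonglongrightarrow> 0"
proof -
  obtain K where K: "K > 0" "\<And>x. norm (T x) \<le> norm x * K"
    using bounded_linear.pos_bounded [OF T] by blast
  have "(norm (T x - T y))\<^sup>2 \<le> K\<^sup>2 * (norm (x - y))\<^sup>2" for x y
    using power_mono [OF K(2) [of "x - y"], of 2]
    by (simp add: power_mult_distrib mult.commute linear_diff bounded_linear.linear [OF T])
  then have le: "(\<integral>\<^sup>+x. ennreal ((norm (T (f x) - T (F j x)))\<^sup>2) \<partial>M) \<le>
      ennreal (K\<^sup>2) * (\<integral>\<^sup>+x. ennreal ((norm (f x - F j x))\<^sup>2) \<partial>M)" for j
    unfolding nn_integral_cmult [OF meas, symmetric]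
    by (intro nn_integral_mono) (simp flip: ennreal_mult)
  have "(\<lambda>j. ennreal (K\<^sup>2) * (\<integral>\<^sup>+x. ennreal ((norm (f x - F j x))\<^sup>2) \<partial>M)) \<longlonglongrightarrow> ennreal (K\<^sup>2) * 0"
    by (intro ennreal_tendsto_cmult lim) simp
  then have upper: "(\<lambda>j. ennreal (K\<^sup>2) * (\<integral>\<^sup>+x. ennreal ((norm (f x - F j x))\<^sup>2) \<partial>M)) \<longlonglongrightarrow> 0"
    by simp
  show ?thesis
    by (rule tendsto_sandwich [OF _ _ tendsto_const upper]) (simp_all add: le)
qed

text \<open>X and Y keep their own approximating sequences. Both sides of the step isometry converge
  by continuity of the L2 inner product, and uniqueness of limits gives the equality.\<close>

lemma wiener_isometry:
  fixes W :: "real \<Rightarrow> 'w \<Rightarrow> real^'m" and f g :: "real \<Rightarrow> real^'m^'d"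
  assumes W: "brownian_motion M W"
    and X: "has_wiener_integral M W f X" and Y: "has_wiener_integral M W g Y"
  shows "(\<integral>x. (\<alpha> \<bullet> X x) * (\<beta> \<bullet> Y x) \<partial>M) =
    (\<integral>s. (transpose (f s) *v \<alpha>) \<bullet> (transpose (g s) *v \<beta>) \<partial>lborel)"
proof -
  have step_meas [measurable]: "step_integral W n t C \<in> borel_measurable M" for n t and C :: "nat \<Rightarrow> real^'m^'d"
    unfolding step_integral_def
    by (intro borel_measurable_sum borel_measurable_continuous_on [of "(*v) _"]
        borel_measurable_diff brownian_motion_measurable [OF W] linear_continuous_on
        matrix_vector_mul_bounded_linear)
  have step_fun_meas [measurable]: "step_fun n t C \<in> borel_measurable lborel" for n t and C :: "nat \<Rightarrow> real^'m^'d"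
    unfolding step_fun_def by measurable
  \<comment> \<open>This map carries the L2 convergence of matrix integrands over to the vectors
    paired on the right-hand side. On the probability side the inner product with a fixed vector
    does the same.\<close>
  have tr: "bounded_linear (\<lambda>F :: real^'m^'d. transpose F *v \<alpha>)" for \<alpha>
    by (rule bounded_linear_compose [OF mvmult.bounded_linear_left bounded_linear_transpose])
  have tr_meas: "(\<lambda>s. transpose (F s) *v \<alpha>) \<in> borel_measurable lborel"
    if "F \<in> borel_measurable lborel" for F :: "real \<Rightarrow> real^'m^'d" and \<alpha>
    by (rule measurable_compose [OF that])
      (intro borel_measurable_continuous_onI linear_continuous_on tr)
  obtain n t C where C: "\<And>j k. k < n j \<Longrightarrow> t j k < t j (Suc k)"
    "(\<lambda>j. \<integral>\<^sup>+s. ennreal ((norm (f s - step_fun (n j) (t j) (C j) s))\<^sup>2) \<partial>lborel) \<longlonglongrightarrow> 0"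
    "(\<lambda>j. \<integral>\<^sup>+x. ennreal ((norm (X x - step_integral W (n j) (t j) (C j) x))\<^sup>2) \<partial>M) \<longlonglongrightarrow> 0"
    and [measurable]: "f \<in> borel_measurable lborel" "X \<in> borel_measurable M"
    using X unfolding has_wiener_integral_def by blast
  obtain n' t' C' where C': "\<And>j k. k < n' j \<Longrightarrow> t' j k < t' j (Suc k)"
    "(\<lambda>j. \<integral>\<^sup>+s. ennreal ((norm (g s - step_fun (n' j) (t' j) (C' j) s))\<^sup>2) \<partial>lborel) \<longlonglongrightarrow> 0"
    "(\<lambda>j. \<integral>\<^sup>+x. ennreal ((norm (Y x - step_integral W (n' j) (t' j) (C' j) x))\<^sup>2) \<partial>M) \<longlonglongrightarrow> 0"
    and [measurable]: "g \<in> borel_measurable lborel" "Y \<in> borel_measurable M"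
    using Y unfolding has_wiener_integral_def by blast
  have sqX: "integrable M (\<lambda>x. (\<alpha> \<bullet> step_integral W (n j) (t j) (C j) x)\<^sup>2)" for j
    unfolding power2_eq_square by (rule step_integral_isometry(1) [OF W]) (rule C(1), assumption)+
  have sqY: "integrable M (\<lambda>x. (\<beta> \<bullet> step_integral W (n' j) (t' j) (C' j) x)\<^sup>2)" for j
    unfolding power2_eq_square by (rule step_integral_isometry(1) [OF W]) (rule C'(1), assumption)+
  have sqf: "integrable lborel (\<lambda>s. (norm (transpose (step_fun (n j) (t j) (C j) s) *v \<alpha>))\<^sup>2)" for j
    unfolding power2_norm_eq_inner
    by (rule step_integral_isometry(2) [OF W]) (rule C(1), assumption)+
  have sqg: "integrable lborel (\<lambda>s. (norm (transpose (step_fun (n' j) (t' j) (C' j) s) *v \<beta>))\<^sup>2)" for j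
    unfolding power2_norm_eq_inner
    by (rule step_integral_isometry(2) [OF W]) (rule C'(1), assumption)+
  have inner_meas: "(\<lambda>x. u \<bullet> Z x) \<in> borel_measurable M" if "Z \<in> borel_measurable M"
    for u :: "real^'d" and Z
    using that by measurable
  have limM: "(\<lambda>j. \<integral>x. (\<alpha> \<bullet> step_integral W (n j) (t j) (C j) x) \<bullet>
      (\<beta> \<bullet> step_integral W (n' j) (t' j) (C' j) x) \<partial>M) \<longlonglongrightarrow> (\<integral>x. (\<alpha> \<bullet> X x) \<bullet> (\<beta> \<bullet> Y x) \<partial>M)"
  proof (rule inner_L2_approx_tendsto)
    show "(\<lambda>j. \<integral>\<^sup>+x. ennreal ((norm (\<alpha> \<bullet> X x - \<alpha> \<bullet> step_integral W (n j) (t j) (C j) x))\<^sup>2) \<partial>M) \<longlonglongrightarrow> 0"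
      by (rule L2_tendsto_bounded_image [OF bounded_linear_inner_right _ C(3)]) simp
    show "(\<lambda>j. \<integral>\<^sup>+x. ennreal ((norm (\<beta> \<bullet> Y x - \<beta> \<bullet> step_integral W (n' j) (t' j) (C' j) x))\<^sup>2) \<partial>M) \<longlonglongrightarrow> 0"
      by (rule L2_tendsto_bounded_image [OF bounded_linear_inner_right _ C'(3)]) simp
    show "integrable M (\<lambda>x. (norm (\<alpha> \<bullet> step_integral W (n j) (t j) (C j) x))\<^sup>2)" for j
      unfolding real_norm_def power2_abs by (rule sqX)
    show "integrable M (\<lambda>x. (norm (\<beta> \<bullet> step_integral W (n' j) (t' j) (C' j) x))\<^sup>2)" for j
      unfolding real_norm_def power2_abs by (rule sqY)
  qed (intro inner_meas step_meas \<open>X \<in> borel_measurable M\<close> \<open>Y \<in> borel_measurable M\<close>)+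
  have limL: "(\<lambda>j. \<integral>s. (transpose (step_fun (n j) (t j) (C j) s) *v \<alpha>) \<bullet>
      (transpose (step_fun (n' j) (t' j) (C' j) s) *v \<beta>) \<partial>lborel) \<longlonglongrightarrow>
      (\<integral>s. (transpose (f s) *v \<alpha>) \<bullet> (transpose (g s) *v \<beta>) \<partial>lborel)"
  proof (rule inner_L2_approx_tendsto)
    show "(\<lambda>j. \<integral>\<^sup>+s. ennreal ((norm (transpose (f s) *v \<alpha> -
        transpose (step_fun (n j) (t j) (C j) s) *v \<alpha>))\<^sup>2) \<partial>lborel) \<longlonglongrightarrow> 0"
      by (rule L2_tendsto_bounded_image [OF tr _ C(2)]) simp
    show "(\<lambda>j. \<integral>\<^sup>+s. ennreal ((norm (transpose (g s) *v \<beta> -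
        transpose (step_fun (n' j) (t' j) (C' j) s) *v \<beta>))\<^sup>2) \<partial>lborel) \<longlonglongrightarrow> 0"
      by (rule L2_tendsto_bounded_image [OF tr _ C'(2)]) simp
  qed (intro sqf sqg tr_meas step_fun_meas \<open>f \<in> borel_measurable lborel\<close>
      \<open>g \<in> borel_measurable lborel\<close>)+
  have eq: "(\<integral>x. (\<alpha> \<bullet> step_integral W (n j) (t j) (C j) x) \<bullet>
      (\<beta> \<bullet> step_integral W (n' j) (t' j) (C' j) x) \<partial>M) =
      (\<integral>s. (transpose (step_fun (n j) (t j) (C j) s) *v \<alpha>) \<bullet>
      (transpose (step_fun (n' j) (t' j) (C' j) s) *v \<beta>) \<partial>lborel)" for j
    unfolding inner_real_def
    by (rule step_integral_isometry(3) [OF W]) (rule C(1) C'(1), assumption)+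
  show ?thesis
    using LIMSEQ_unique [OF limM [unfolded eq] limL] by (simp only: inner_real_def)
qed

section \<open>Integrals over the half line\<close>

lemma set_integral_bounded_linear_image:
  fixes f :: "'a \<Rightarrow> 'b::{banach, second_countable_topology}"
    and T :: "'b \<Rightarrow> 'c::{banach, second_countable_topology}"
  assumes T: "bounded_linear T" and f: "set_integrable M S f"
  shows "set_integrable M S (\<lambda>x. T (f x))" and "(LINT x:S|M. T (f x)) = T (LINT x:S|M. f x)"
proof -
  have eq: "indicator S x *\<^sub>R T (f x) = T (indicator S x *\<^sub>R f x)" for x
    using bounded_linear.linear [OF T] by (simp add: linear_scale)
  show "set_integrable M S (\<lambda>x. T (f x))"
    using integrable_bounded_linear [OF T] f unfolding set_integrable_def eq .
  show "(LINT x:S|M. T (f x)) = T (LINT x:S|M. f x)"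
    using integral_bounded_linear [OF T] f
    unfolding set_integrable_def set_lebesgue_integral_def eq by blast
qed

lemma exponential_decay_set_integrable:
  fixes f :: "real \<Rightarrow> 'a::{banach, second_countable_topology}"
  assumes [measurable]: "f \<in> borel_measurable borel" and "l > 0"
    and bound: "\<And>t. t \<ge> 0 \<Longrightarrow> norm (f t) \<le> K * exp (- l * t)"
  shows "set_integrable lborel {0..} f"
proof -
  \<comment> \<open>The exponential is first integrable in the gauge sense. Nonnegativity makes it
    absolutely integrable for the completed measure, and Borel measurability brings this back to
    \<open>lborel\<close>.\<close>
  have "integrable lebesgue (\<lambda>t. indicator {0..} t *\<^sub>R exp (- l * t))"
    using \<open>l > 0\<close>
    by (intro nonnegative_absolutely_integrable_1 [unfolded set_integrable_def]
        integrable_on_exp_minus_to_infinity) auto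
  then have "integrable lborel (\<lambda>t. indicator {0..} t *\<^sub>R exp (- l * t))"
    by (subst (asm) integrable_completion) auto
  then have "integrable lborel (\<lambda>t. K * (indicator {0..} t *\<^sub>R exp (- l * t)))"
    by (rule integrable_mult_right)
  then show ?thesis
    unfolding set_integrable_def
  proof (rule Bochner_Integration.integrable_bound)
    show "AE t in lborel. norm (indicator {0..} t *\<^sub>R f t) \<le>
        norm (K * (indicator {0..} t *\<^sub>R exp (- l * t)))"
      using order_trans [OF bound abs_ge_self] by (auto simp: indicator_def)
  qed measurable
qed

lemma exponential_decay_tendsto_0:
  fixes f :: "real \<Rightarrow> 'a::real_normed_vector"
  assumes "l > 0" and bound: "\<And>t. t \<ge> 0 \<Longrightarrow> norm (f t) \<le> K * exp (- l * t)"
  shows "(f \<longlongrightarrow> 0) at_top"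
proof (rule Lim_null_comparison)
  show "\<forall>\<^sub>F t in at_top. norm (f t) \<le> K * exp (- l * t)"
    using eventually_ge_at_top [of 0] by eventually_elim (rule bound)
  have "filterlim (\<lambda>t. - l * t) at_bot at_top"
    using \<open>l > 0\<close> by (intro filterlim_tendsto_neg_mult_at_bot [OF tendsto_const _ filterlim_ident]) simp
  from tendsto_mult_right_zero [OF filterlim_compose [OF exp_at_bot this]]
  show "((\<lambda>t. K * exp (- l * t)) \<longlongrightarrow> 0) at_top" .
qed

text \<open>The interval integral in the fundamental theorem of calculus runs over an open interval,
  while the transforms are integrals over the closed half line. The endpoint is a null set.\<close>

lemma set_integral_Ici_eq_Ioi:
  fixes f :: "real \<Rightarrow> 'a::{banach, second_countable_topology}"
  assumes [measurable]: "f \<in> borel_measurable borel"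
  shows "(LINT t:{0..}|lborel. f t) = (LINT t:{0<..}|lborel. f t)"
  unfolding set_lebesgue_integral_def
proof (rule integral_cong_AE)
  show "AE t in lborel. indicator {0..} t *\<^sub>R f t = indicator {0<..} t *\<^sub>R f t"
    using AE_lborel_singleton [of "0 :: real"] by eventually_elim (auto simp: indicator_def)
qed measurable

lemma set_integral_FTC_Ici:
  fixes F f :: "real \<Rightarrow> 'a::euclidean_space"
  assumes deriv: "\<And>t. (F has_vector_derivative f t) (at t)"
    and cont: "continuous_on UNIV f"
    and int: "set_integrable lborel {0..} f"
    and lim: "(F \<longlongrightarrow> 0) at_top"
  shows "(LINT t:{0..}|lborel. f t) = - F 0"
proof -
  have "(LBINT t=ereal 0..\<infinity>. f t) = 0 - F 0"
  proof (rule interval_integral_FTC_integrable [OF _ deriv])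
    show "isCont f t" for t
      using cont by (simp add: continuous_on_eq_continuous_at)
    show "set_integrable lborel (einterval (ereal 0) \<infinity>) f"
      using int by (rule set_integrable_subset) auto
    have "(F \<longlongrightarrow> F 0) (at 0)"
      using has_vector_derivative_continuous [OF deriv] by (simp add: isCont_def)
    then show "((F \<circ> real_of_ereal) \<longlongrightarrow> F 0) (at_right (ereal 0))"
      unfolding ereal_tendsto_simps by (rule filterlim_mono) (simp_all add: at_le)
    show "((F \<circ> real_of_ereal) \<longlongrightarrow> 0) (at_left \<infinity>)"
      unfolding ereal_tendsto_simps by (rule lim)
  qed simp
  moreover have "f \<in> borel_measurable borel"
    using cont by (rule borel_measurable_continuous_onI)
  ultimately show ?thesis
    by (simp add: set_integral_Ici_eq_Ioi interval_integral_to_infinity_eq)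
qed

text \<open>The negative half line is reflected onto the positive one, where the two conjugate
  exponentials add up to twice a cosine. Writing the even function through the absolute value of t
  means that only its values on the half line enter.\<close>

lemma even_fourier_integral:
  fixes \<phi> :: "real \<Rightarrow> real"
  assumes [measurable]: "\<phi> \<in> borel_measurable borel" and int: "set_integrable lborel {0..} \<phi>"
  shows "(LINT t|lborel. complex_of_real (\<phi> \<bar>t\<bar>) * exp (- \<i> * complex_of_real (\<omega> * t))) =
    complex_of_real (2 * (LINT t:{0..}|lborel. cos (\<omega> * t) * \<phi> t))"
proof -
  define h where "h t = complex_of_real (\<phi> \<bar>t\<bar>) * exp (- \<i> * complex_of_real (\<omega> * t))" for t
  have [measurable]: "h \<in> borel_measurable borel"
    unfolding h_def [abs_def] by measurable
  have norm_h: "norm (h t) = \<bar>\<phi> \<bar>t\<bar>\<bar>" for t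
    by (simp add: h_def norm_mult)
  have int_h: "integrable lborel (\<lambda>t. indicator {0..} t *\<^sub>R h t)"
    by (rule Bochner_Integration.integrable_bound [OF int [unfolded set_integrable_def]])
      (measurable, simp add: norm_h indicator_def)
  have int_h': "integrable lborel (\<lambda>t. indicator {0..} t *\<^sub>R h (- t))"
    by (rule Bochner_Integration.integrable_bound [OF int [unfolded set_integrable_def]])
      (measurable, simp add: norm_h indicator_def)
  have neg: "integrable lborel (\<lambda>t. indicator {..0} t *\<^sub>R h t)"
    "(LINT t|lborel. indicator {..0} t *\<^sub>R h t) = (LINT t|lborel. indicator {0..} t *\<^sub>R h (- t))"
  proof -
    have eq: "indicator {..0} (0 + -1 * t) *\<^sub>R h (0 + -1 * t) = indicator {0..} t *\<^sub>R h (- t)" for t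
      by (simp add: indicator_def)
    show "integrable lborel (\<lambda>t. indicator {..0} t *\<^sub>R h t)"
      using int_h' lborel_integrable_real_affine_iff [of "-1" "\<lambda>t. indicator {..0} t *\<^sub>R h t" 0]
      unfolding eq by simp
    show "(LINT t|lborel. indicator {..0} t *\<^sub>R h t) = (LINT t|lborel. indicator {0..} t *\<^sub>R h (- t))"
      using lborel_integral_real_affine [of "-1" "\<lambda>t. indicator {..0} t *\<^sub>R h t" 0]
      unfolding eq by simp
  qed
  have "(LINT t|lborel. h t) = (LINT t|lborel. indicator {0..} t *\<^sub>R h t + indicator {..0} t *\<^sub>R h t)"
  proof (rule integral_cong_AE)
    \<comment> \<open>Both half lines contain 0, so the decomposition fails at that point and holds
      only almost everywhere.\<close>
    show "AE t in lborel. h t = indicator {0..} t *\<^sub>R h t + indicator {..0} t *\<^sub>R h t"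
      using AE_lborel_singleton [of "0 :: real"] by eventually_elim (auto simp: indicator_def)
  qed measurable
  also have "\<dots> = (LINT t|lborel. indicator {0..} t *\<^sub>R h t + indicator {0..} t *\<^sub>R h (- t))"
    using int_h int_h' neg by simp
  also have "\<dots> = (LINT t|lborel. complex_of_real (2 * (indicator {0..} t *\<^sub>R (cos (\<omega> * t) * \<phi> t))))"
  proof (rule Bochner_Integration.integral_cong)
    show "indicator {0..} t *\<^sub>R h t + indicator {0..} t *\<^sub>R h (- t) =
        complex_of_real (2 * (indicator {0..} t *\<^sub>R (cos (\<omega> * t) * \<phi> t)))" for t
    proof (cases "t \<ge> 0")
      case True
      have "exp (- (\<i> * z)) + exp (\<i> * z) = 2 * cos z" for z
        by (simp add: cos_exp_eq)
      from this [of "complex_of_real (\<omega> * t)"] cos_of_real [of "\<omega> * t", where 'a = complex] True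
      show ?thesis
        by (simp add: h_def flip: distrib_left)
    qed simp
  qed simp
  also have "\<dots> = complex_of_real (2 * (LINT t:{0..}|lborel. cos (\<omega> * t) * \<phi> t))"
    unfolding set_lebesgue_integral_def integral_complex_of_real integral_mult_right_zero ..
  finally show ?thesis
    by (simp only: h_def)
qed

lemma inner_transpose_matrix_vector: "(transpose X *v u) \<bullet> w = u \<bullet> (X *v w)"
  for X :: "real^'n^'m"
  by (simp add: dot_lmul_matrix)

section \<open>The stationary covariance and the spectral density\<close>

text \<open>Stability enters from here on only through the decay bound. Fixing its constants once
  lets all integrals share them.\<close>

locale stable_matrix =
  fixes A :: "real^'d^'d" and K l :: real
  assumes rate_pos: "l > 0"
    and decay: "\<And>t. t \<ge> 0 \<Longrightarrow> norm (mexp (t *\<^sub>R A)) \<le> K * exp (- l * t)"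
begin

lemma K_nonneg: "K \<ge> 0"
  using order_trans [OF norm_ge_zero decay [of 0]] by simp

lemma covariance_integrand_decay:
  "\<exists>C. \<forall>t\<ge>0. norm (mexp (t *\<^sub>R A) ** Q ** transpose (mexp (t *\<^sub>R A))) \<le> C * exp (- l * t)"
proof -
  obtain c where c: "c > 0" "\<And>(X :: real^'d^'d) (Y :: real^'d^'d). norm (X ** Y) \<le> norm X * norm Y * c"
    using mmult.pos_bounded by blast
  obtain b where b: "b > 0" "\<And>X :: real^'d^'d. norm (transpose X) \<le> norm X * b"
    using bounded_linear.pos_bounded [OF bounded_linear_transpose] by blast
  have "norm (mexp (t *\<^sub>R A) ** Q ** transpose (mexp (t *\<^sub>R A))) \<le>
      (K * norm Q * c * (K * b) * c) * exp (- l * t)" if "t \<ge> 0" for t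
  proof -
    let ?E = "mexp (t *\<^sub>R A)"
    \<comment> \<open>The decay of one of the two exponential factors is given away. The other one
      alone provides the rate l.\<close>
    have "norm ?E \<le> K * 1"
      using decay [OF that] K_nonneg rate_pos that
      by (elim order_trans) (intro mult_left_mono, auto)
    then have "norm (transpose ?E) \<le> K * b"
      using b(2) [of ?E] b(1) by (smt (verit) mult_right_mono)
    moreover have "norm (?E ** Q) \<le> K * exp (- l * t) * norm Q * c"
      using c(2) [of ?E Q] decay [OF that] c(1)
      by (elim order_trans) (intro mult_right_mono, auto)
    ultimately have "norm (?E ** Q) * norm (transpose ?E) * c \<le>
        (K * exp (- l * t) * norm Q * c) * (K * b) * c"
      using c(1) K_nonneg by (intro mult_right_mono mult_mono) auto
    then show ?thesis
      using c(2) [of "?E ** Q" "transpose ?E"] by (simp add: mult_ac)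
  qed
  then show ?thesis by blast
qed

lemma covariance_integrand_integrable:
  "set_integrable lborel {0..} (\<lambda>t. mexp (t *\<^sub>R A) ** Q ** transpose (mexp (t *\<^sub>R A)))"
proof -
  obtain C where C: "\<And>t. t \<ge> 0 \<Longrightarrow>
      norm (mexp (t *\<^sub>R A) ** Q ** transpose (mexp (t *\<^sub>R A))) \<le> C * exp (- l * t)"
    using covariance_integrand_decay by blast
  show ?thesis
  proof (rule exponential_decay_set_integrable [OF _ rate_pos C])
    show "(\<lambda>t. mexp (t *\<^sub>R A) ** Q ** transpose (mexp (t *\<^sub>R A))) \<in> borel_measurable borel"
      by (intro borel_measurable_continuous_onI mmult.continuous_on continuous_on_const
          continuous_on_mexp continuous_on_id
          bounded_linear.continuous_on [OF bounded_linear_transpose])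
  qed
qed

lemma stationary_cov_eq:
  "stationary_cov A B = (LINT t:{0..}|lborel. mexp (t *\<^sub>R A) ** (B ** transpose B) ** transpose (mexp (t *\<^sub>R A)))"
  by (simp add: stationary_cov_def matrix_mul_assoc flip: mexp_transpose transpose_scalar)

lemma stationary_cov_symmetric: "transpose (stationary_cov A B) = stationary_cov A B"
  unfolding stationary_cov_eq
    set_integral_bounded_linear_image(2)
      [OF bounded_linear_transpose covariance_integrand_integrable, symmetric]
  by (simp add: matrix_transpose_mul matrix_mul_assoc)

lemma lyapunov_equation:
  "A ** stationary_cov A B + stationary_cov A B ** transpose A = - (B ** transpose B)"
proof -
  define G where "G t = mexp (t *\<^sub>R A) ** (B ** transpose B) ** transpose (mexp (t *\<^sub>R A))" for t
  have int: "set_integrable lborel {0..} G"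
    unfolding G_def [abs_def] by (rule covariance_integrand_integrable)
  \<comment> \<open>The integrand G has derivative T (G t). As T is bounded and linear, it can be
    taken out of the integral, where it meets the stationary covariance.\<close>
  have T: "bounded_linear (\<lambda>X :: real^'d^'d. A ** X + X ** transpose A)"
    by (intro bounded_linear_add mmult.bounded_linear_left mmult.bounded_linear_right)
  have G_deriv: "(G has_vector_derivative A ** G t + G t ** transpose A) (at t)" for t
    unfolding G_def
    by (rule has_vector_derivative_eq_rhs, (rule mmult.has_vector_derivative
        bounded_linear.has_vector_derivative [OF bounded_linear_transpose]
        mexp_has_vector_derivative has_vector_derivative_const)+)
      (simp add: matrix_transpose_mul matrix_mul_assoc mmult.zero_right add.commute)
  have "(LINT t:{0..}|lborel. A ** G t + G t ** transpose A) = - G 0"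
  proof (rule set_integral_FTC_Ici [OF G_deriv])
    have "continuous_on UNIV G"
      using has_vector_derivative_continuous [OF G_deriv]
      by (auto simp: continuous_on_eq_continuous_within)
    then show "continuous_on UNIV (\<lambda>t. A ** G t + G t ** transpose A)"
      by (intro bounded_linear.continuous_on [OF T])
    obtain C where "\<And>t. t \<ge> 0 \<Longrightarrow> norm (G t) \<le> C * exp (- l * t)"
      unfolding G_def using covariance_integrand_decay by blast
    then show "(G \<longlongrightarrow> 0) at_top"
      by (rule exponential_decay_tendsto_0 [OF rate_pos])
  qed (rule set_integral_bounded_linear_image(1) [OF T int])
  then show ?thesis
    unfolding set_integral_bounded_linear_image(2) [OF T int]
    by (simp add: stationary_cov_eq G_def [abs_def] transpose_mat)
qed

section \<open>The cosine transform\<close>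

lemma cosine_integrand_integrable:
  "set_integrable lborel {0..} (\<lambda>t. cos (\<omega> * t) *\<^sub>R mexp (t *\<^sub>R A))"
proof (rule exponential_decay_set_integrable [OF _ rate_pos])
  show "norm (cos (\<omega> * t) *\<^sub>R mexp (t *\<^sub>R A)) \<le> K * exp (- l * t)" if "t \<ge> 0" for t
    using mult_mono [OF abs_cos_le_one [of "\<omega> * t"] decay [OF that]] by simp
qed measurable

lemma cosine_transform_image:
  fixes T :: "real^'d^'d \<Rightarrow> 'b::{banach, second_countable_topology}"
  assumes "bounded_linear T"
  shows "T (cosine_transform A \<omega>) = (1 / pi) *\<^sub>R (LINT t:{0..}|lborel. cos (\<omega> * t) *\<^sub>R T (mexp (t *\<^sub>R A)))"
proof -
  have "T (LINT t:{0..}|lborel. cos (\<omega> * t) *\<^sub>R mexp (t *\<^sub>R A)) =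
      (LINT t:{0..}|lborel. T (cos (\<omega> * t) *\<^sub>R mexp (t *\<^sub>R A)))"
    by (rule set_integral_bounded_linear_image(2) [OF assms cosine_integrand_integrable, symmetric])
  then show ?thesis
    using bounded_linear.linear [OF assms] by (simp add: cosine_transform_def linear_scale)
qed

lemma cosine_transform_commute: "A ** cosine_transform A \<omega> = cosine_transform A \<omega> ** A"
  using cosine_transform_image [OF mmult.bounded_linear_right [of A]]
    cosine_transform_image [OF mmult.bounded_linear_left [of A]]
  by (simp only: mexp_commute)

lemma cosine_transform_resolvent:
  "A ** A ** cosine_transform A \<omega> + \<omega>\<^sup>2 *\<^sub>R cosine_transform A \<omega> = - ((1 / pi) *\<^sub>R A)"
proof -
  define T where "T X = A ** A ** X + \<omega>\<^sup>2 *\<^sub>R X" for X :: "real^'d^'d"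
  have T: "bounded_linear T"
    unfolding T_def [abs_def]
    by (intro bounded_linear_add mmult.bounded_linear_right bounded_linear_scaleR_right)
  \<comment> \<open>An antiderivative of cos(\<omega> t) T(mexp(t A)), as found by integrating by
    parts twice. On differentiation the sine terms cancel, and \<open>F 0\<close> is A, whence the
    right-hand side.\<close>
  define F where "F t = cos (\<omega> * t) *\<^sub>R (A ** mexp (t *\<^sub>R A)) + (\<omega> * sin (\<omega> * t)) *\<^sub>R mexp (t *\<^sub>R A)" for t
  have F_deriv: "(F has_vector_derivative cos (\<omega> * t) *\<^sub>R T (mexp (t *\<^sub>R A))) (at t)" for t
  proof -
    have "((\<lambda>t. cos (\<omega> * t)) has_vector_derivative - (\<omega> * sin (\<omega> * t))) (at t)"
      by (auto intro!: derivative_eq_intros simp flip: has_real_derivative_iff_has_vector_derivative)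
    moreover have "((\<lambda>t. \<omega> * sin (\<omega> * t)) has_vector_derivative \<omega>\<^sup>2 * cos (\<omega> * t)) (at t)"
      by (auto intro!: derivative_eq_intros simp: power2_eq_square
          simp flip: has_real_derivative_iff_has_vector_derivative)
    moreover have "((\<lambda>t. A ** mexp (t *\<^sub>R A)) has_vector_derivative A ** (A ** mexp (t *\<^sub>R A))) (at t)"
      by (rule bounded_linear.has_vector_derivative [OF mmult.bounded_linear_right
            mexp_has_vector_derivative])
    ultimately have "(F has_vector_derivative
        (cos (\<omega> * t) *\<^sub>R (A ** (A ** mexp (t *\<^sub>R A))) + (- (\<omega> * sin (\<omega> * t))) *\<^sub>R (A ** mexp (t *\<^sub>R A))) +
        ((\<omega> * sin (\<omega> * t)) *\<^sub>R (A ** mexp (t *\<^sub>R A)) + (\<omega>\<^sup>2 * cos (\<omega> * t)) *\<^sub>R mexp (t *\<^sub>R A))) (at t)"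
      unfolding F_def
      by (intro has_vector_derivative_add mexp_has_vector_derivative
          bounded_bilinear.has_vector_derivative [OF bounded_bilinear_scaleR])
    then show ?thesis
      by (rule has_vector_derivative_eq_rhs)
        (simp add: T_def matrix_mul_assoc scaleR_add_right mult.commute)
  qed
  obtain c where c: "c > 0" "\<And>(X :: real^'d^'d) (Y :: real^'d^'d). norm (X ** Y) \<le> norm X * norm Y * c"
    using mmult.pos_bounded by blast
  have "norm (F t) \<le> ((norm A * c + \<bar>\<omega>\<bar>) * K) * exp (- l * t)" if "t \<ge> 0" for t
  proof -
    let ?E = "mexp (t *\<^sub>R A)"
    have "norm (F t) \<le> \<bar>cos (\<omega> * t)\<bar> * norm (A ** ?E) + \<bar>\<omega>\<bar> * \<bar>sin (\<omega> * t)\<bar> * norm ?E"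
      unfolding F_def by (rule norm_triangle_le) (simp add: abs_mult)
    also have "\<dots> \<le> 1 * (norm A * norm ?E * c) + \<bar>\<omega>\<bar> * 1 * norm ?E"
      using c by (intro add_mono mult_mono mult_left_mono) auto
    also have "\<dots> = (norm A * c + \<bar>\<omega>\<bar>) * norm ?E"
      by (simp add: algebra_simps)
    also have "\<dots> \<le> (norm A * c + \<bar>\<omega>\<bar>) * (K * exp (- l * t))"
      using c(1) decay [OF that] by (intro mult_left_mono) auto
    finally show ?thesis by (simp add: mult.assoc)
  qed
  then have F_lim: "(F \<longlongrightarrow> 0) at_top"
    by (rule exponential_decay_tendsto_0 [OF rate_pos])
  have "set_integrable lborel {0..} (\<lambda>t. T (cos (\<omega> * t) *\<^sub>R mexp (t *\<^sub>R A)))"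
    by (rule set_integral_bounded_linear_image(1) [OF T cosine_integrand_integrable])
  then have int: "set_integrable lborel {0..} (\<lambda>t. cos (\<omega> * t) *\<^sub>R T (mexp (t *\<^sub>R A)))"
    using bounded_linear.linear [OF T] by (simp add: linear_scale)
  have cont: "continuous_on UNIV (\<lambda>t. cos (\<omega> * t) *\<^sub>R T (mexp (t *\<^sub>R A)))"
    by (intro continuous_on_scaleR continuous_on_cos continuous_on_mult_left continuous_on_id
        bounded_linear.continuous_on [OF T] continuous_on_mexp)
  have "T (cosine_transform A \<omega>) = (1 / pi) *\<^sub>R - F 0"
    unfolding cosine_transform_image [OF T] set_integral_FTC_Ici [OF F_deriv cont int F_lim] ..
  then show ?thesis
    by (simp add: T_def F_def)
qed

lemma lambda2_eq_cosine_integral: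
  assumes "\<omega> \<noteq> 0"
  shows "lambda2 A B (transpose A *v \<alpha>) (transpose B *v \<alpha>) \<omega> =
    (LINT t:{0..}|lborel. cos (\<omega> * t) * (\<alpha> \<bullet> (mexp (t *\<^sub>R A) *v (stationary_cov A B *v \<alpha>))))"
proof -
  let ?R = "stationary_cov A B" and ?S = "cosine_transform A \<omega>"
  note adj = inner_transpose_matrix_vector
  have sq: "(norm (transpose B *v \<alpha>))\<^sup>2 = \<alpha> \<bullet> ((B ** transpose B) *v \<alpha>)"
    by (simp only: power2_norm_eq_inner adj matrix_vector_mul_assoc)
  \<comment> \<open>Symmetry of R makes the two Lyapunov terms transposes of each other, so they
    have the same quadratic form. Each therefore carries half of the right-hand side, the origin of
    the factor 2 in the white noise term.\<close>
  have "\<alpha> \<bullet> ((?R ** transpose A) *v \<alpha>) = \<alpha> \<bullet> ((A ** ?R) *v \<alpha>)"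
  proof -
    have "\<alpha> \<bullet> ((A ** ?R) *v \<alpha>) = (transpose (A ** ?R) *v \<alpha>) \<bullet> \<alpha>"
      by (rule adj [symmetric])
    then show ?thesis
      by (simp only: matrix_transpose_mul stationary_cov_symmetric inner_commute)
  qed
  moreover have "\<alpha> \<bullet> ((A ** ?R + ?R ** transpose A) *v \<alpha>) = - (norm (transpose B *v \<alpha>))\<^sup>2"
    by (simp only: lyapunov_equation sq mvmult.minus_left inner_minus_right)
  ultimately have quad: "\<alpha> \<bullet> ((A ** ?R) *v \<alpha>) = - (norm (transpose B *v \<alpha>))\<^sup>2 / 2"
    by (simp only: mvmult.add_left inner_add_right)
  have RB: "?R ** transpose A + B ** transpose B = - (A ** ?R)"
    using lyapunov_equation [of B] by (simp add: algebra_simps eq_neg_iff_add_eq_0)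
  have "(transpose A *v \<alpha>) \<bullet> (?S *v (?R *v (transpose A *v \<alpha>))) +
      (transpose A *v \<alpha>) \<bullet> (?S *v (B *v (transpose B *v \<alpha>))) =
      \<alpha> \<bullet> ((A ** ?S ** (?R ** transpose A + B ** transpose B)) *v \<alpha>)"
    by (simp only: adj mmult.add_right mvmult.add_left inner_add_right matrix_vector_mul_assoc
        matrix_mul_assoc)
  \<comment> \<open>The second A, brought in by the Lyapunov equation, stands to the right of S and
    is moved past it by commutation.\<close>
  also have "A ** ?S ** (?R ** transpose A + B ** transpose B) = - (A ** A ** ?S ** ?R)"
    unfolding RB mmult.minus_right
    by (metis cosine_transform_commute matrix_mul_assoc)
  also have "- (A ** A ** ?S ** ?R) = \<omega>\<^sup>2 *\<^sub>R (?S ** ?R) + (1 / pi) *\<^sub>R (A ** ?R)"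
  proof -
    have "A ** A ** ?S = - (\<omega>\<^sup>2 *\<^sub>R ?S + (1 / pi) *\<^sub>R A)"
      using cosine_transform_resolvent [of \<omega>] by (simp add: algebra_simps eq_neg_iff_add_eq_0)
    then show ?thesis
      by (simp only: mmult.minus_left mmult.add_left mmult.scaleR_left minus_minus)
  qed
  also have "\<alpha> \<bullet> ((\<omega>\<^sup>2 *\<^sub>R (?S ** ?R) + (1 / pi) *\<^sub>R (A ** ?R)) *v \<alpha>) =
      \<omega>\<^sup>2 * (\<alpha> \<bullet> (?S *v (?R *v \<alpha>))) - (norm (transpose B *v \<alpha>))\<^sup>2 / (2 * pi)"
    by (simp add: mvmult.add_left mvmult.scaleR_left inner_add_right quad matrix_vector_mul_assoc)
  finally have "lambda2 A B (transpose A *v \<alpha>) (transpose B *v \<alpha>) \<omega> =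
      pi * (\<alpha> \<bullet> (?S *v (?R *v \<alpha>)))"
    unfolding lambda2_def using assms by simp
  also have "\<dots> = (LINT t:{0..}|lborel. cos (\<omega> * t) * (\<alpha> \<bullet> (mexp (t *\<^sub>R A) *v (?R *v \<alpha>))))"
    using cosine_transform_image [of "\<lambda>X. \<alpha> \<bullet> (X *v (?R *v \<alpha>))"]
    by (simp add: bounded_linear_compose [OF bounded_linear_inner_right mvmult.bounded_linear_left])
  finally show ?thesis .
qed

section \<open>Autocovariance and spectral density of the stationary solution\<close>

lemma stationary_autocovariance:
  assumes W: "brownian_motion M W" and v: "stationary_solution M W A B v" and "s \<le> t"
  shows "(LINT x|M. (\<alpha> \<bullet> v t x) * (\<alpha> \<bullet> v s x)) =
    \<alpha> \<bullet> (mexp ((t - s) *\<^sub>R A) *v (stationary_cov A B *v \<alpha>))"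
proof -
  define G where "G u = mexp (u *\<^sub>R A) ** (B ** transpose B) ** transpose (mexp (u *\<^sub>R A))" for u
  define T where "T X = \<alpha> \<bullet> (mexp ((t - s) *\<^sub>R A) *v (X *v \<alpha>))" for X :: "real^'d^'d"
  have T: "bounded_linear T"
    unfolding T_def [abs_def]
    by (intro bounded_linear_compose [OF bounded_linear_inner_right]
        bounded_linear_compose [OF mvmult.bounded_linear_right] mvmult.bounded_linear_left)
  have wiener: "has_wiener_integral M W (\<lambda>r. indicator {..u} r *\<^sub>R (mexp ((u - r) *\<^sub>R A) ** B)) (v u)" for u
    using v by (simp add: stationary_solution_def)
  have "(transpose (indicator {..t} r *\<^sub>R (mexp ((t - r) *\<^sub>R A) ** B)) *v \<alpha>) \<bullet>
      (transpose (indicator {..s} r *\<^sub>R (mexp ((s - r) *\<^sub>R A) ** B)) *v \<alpha>) =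
      indicator {..s} r *\<^sub>R T (G (s - r))" for r
  proof (cases "r \<le> s")
    case True
    \<comment> \<open>The semigroup law separates the lag t - s from the common past up to s. Noise
      after s contributes nothing, since the indicator of the earlier integrand vanishes
      there.\<close>
    have "mexp ((t - r) *\<^sub>R A) = mexp ((t - s) *\<^sub>R A) ** mexp ((s - r) *\<^sub>R A)"
      by (simp flip: mexp_add)
    then have "(transpose (mexp ((t - r) *\<^sub>R A) ** B) *v \<alpha>) \<bullet> (transpose (mexp ((s - r) *\<^sub>R A) ** B) *v \<alpha>) =
        T (G (s - r))"
      unfolding T_def G_def inner_transpose_matrix_vector
      by (simp only: matrix_transpose_mul matrix_vector_mul_assoc matrix_mul_assoc)
    then show ?thesis
      using True \<open>s \<le> t\<close> by simp
  qed simp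
  then have "(LINT x|M. (\<alpha> \<bullet> v t x) * (\<alpha> \<bullet> v s x)) = (LINT r|lborel. indicator {..s} r *\<^sub>R T (G (s - r)))"
    by (simp only: wiener_isometry [OF W wiener wiener])
  \<comment> \<open>Substitution u = s - r, which turns the past of s into the half line of the
    covariance integral.\<close>
  also have "\<dots> = (LINT u|lborel. indicator {..s} (s + -1 * u) *\<^sub>R T (G (s - (s + -1 * u))))"
    by (subst lborel_integral_real_affine [of "-1" _ s]) simp_all
  also have "\<dots> = (LINT u:{0..}|lborel. T (G u))"
    unfolding set_lebesgue_integral_def
    by (rule Bochner_Integration.integral_cong) (simp_all add: indicator_def)
  also have "\<dots> = T (stationary_cov A B)"
    unfolding stationary_cov_eq G_def
    by (rule set_integral_bounded_linear_image(2) [OF T covariance_integrand_integrable])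
  finally show ?thesis
    by (simp only: T_def)
qed

lemma stationary_power_spectral_density:
  assumes W: "brownian_motion M W" and v: "stationary_solution M W A B v"
  shows "complex_of_real pi * power_spectral_density M (\<lambda>t x. \<alpha> \<bullet> v t x) \<omega> = complex_of_real
    (LINT t:{0..}|lborel. cos (\<omega> * t) * (\<alpha> \<bullet> (mexp (t *\<^sub>R A) *v (stationary_cov A B *v \<alpha>))))"
proof -
  define T where "T X = \<alpha> \<bullet> (X *v (stationary_cov A B *v \<alpha>))" for X :: "real^'d^'d"
  define \<phi> where "\<phi> t = T (mexp (t *\<^sub>R A))" for t
  have T: "bounded_linear T"
    unfolding T_def [abs_def]
    by (rule bounded_linear_compose [OF bounded_linear_inner_right mvmult.bounded_linear_left])
  \<comment> \<open>Frequency 0 turns the cosine factor into 1.\<close>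
  have "set_integrable lborel {0..} (\<lambda>t. mexp (t *\<^sub>R A))"
    using cosine_integrand_integrable [of 0] by simp
  then have int: "set_integrable lborel {0..} \<phi>"
    unfolding \<phi>_def [abs_def] by (rule set_integral_bounded_linear_image(1) [OF T])
  have meas: "\<phi> \<in> borel_measurable borel"
    unfolding \<phi>_def [abs_def]
    by (intro borel_measurable_continuous_onI bounded_linear.continuous_on [OF T]
        continuous_on_mexp continuous_on_id)
  have "(LINT x|M. (\<alpha> \<bullet> v t x) * (\<alpha> \<bullet> v 0 x)) = \<phi> \<bar>t\<bar>" for t
  proof (cases "t \<ge> 0")
    case True
    then show ?thesis
      using stationary_autocovariance [OF W v True, of \<alpha>] by (simp add: \<phi>_def T_def)
  next
    \<comment> \<open>For negative t the two times exchange roles: t is the earlier one and the lag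
      is -t.\<close>
    case False
    then show ?thesis
      using stationary_autocovariance [OF W v, of t 0 \<alpha>] by (simp add: \<phi>_def T_def mult.commute)
  qed
  then have "power_spectral_density M (\<lambda>t x. \<alpha> \<bullet> v t x) \<omega> =
      1 / (2 * complex_of_real pi) * complex_of_real (2 * (LINT t:{0..}|lborel. cos (\<omega> * t) * \<phi> t))"
    unfolding power_spectral_density_def by (simp only: even_fourier_integral [OF meas int])
  then show ?thesis
    by (simp add: \<phi>_def T_def)
qed

end

text \<open>The inner product with \<alpha> passes through the drift integral because the path is
  continuous, hence integrable on compact intervals. Moving A and B to the other side of the inner
  product gives the coefficients. One null set serves all pairs of times.\<close>

lemma linear_observable_increment:
  assumes "solves_linear_sde M W A B v"
  shows "AE x in M. \<forall>s t. s \<le> t \<longrightarrow> \<alpha> \<bullet> v t x - \<alpha> \<bullet> v s x =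
    integral {s..t} (\<lambda>r. (transpose A *v \<alpha>) \<bullet> v r x) + (transpose B *v \<alpha>) \<bullet> (W t x - W s x)"
  using assms unfolding solves_linear_sde_def
proof eventually_elim
  case (elim x)
  show ?case
  proof (intro allI impI)
    fix s t :: real
    assume "s \<le> t"
    have "continuous_on {s..t} (\<lambda>r. A *v v r x)"
      using elim continuous_on_subset
      by (blast intro: bounded_linear.continuous_on [OF matrix_vector_mul_bounded_linear])
    then have "(\<lambda>r. A *v v r x) integrable_on {s..t}"
      by (rule integrable_continuous_real)
    then have "integral {s..t} (\<lambda>r. \<alpha> \<bullet> (A *v v r x)) = \<alpha> \<bullet> integral {s..t} (\<lambda>r. A *v v r x)"
      using integral_linear [OF _ bounded_linear_inner_right [of \<alpha>]] by (simp add: o_def)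
    moreover have "v t x - v s x = integral {s..t} (\<lambda>r. A *v v r x) + B *v (W t x - W s x)"
      using elim \<open>s \<le> t\<close> by blast
    ultimately show "\<alpha> \<bullet> v t x - \<alpha> \<bullet> v s x =
        integral {s..t} (\<lambda>r. (transpose A *v \<alpha>) \<bullet> v r x) + (transpose B *v \<alpha>) \<bullet> (W t x - W s x)"
      by (simp add: dot_lmul_matrix inner_add_right flip: inner_diff_right)
  qed
qed

theorem proposition5p1:
  fixes M :: "'w measure"
    and W :: "real \<Rightarrow> 'w \<Rightarrow> real^'m"
    and A :: "real^'d^'d"
    and B :: "real^'m^'d"
    and v :: "real \<Rightarrow> 'w \<Rightarrow> real^'d"
    and V :: "real \<Rightarrow> 'w \<Rightarrow> real"
    and \<alpha> a :: "real^'d"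
    and \<gamma> :: "real^'m"
  assumes "\<And>\<mu>. eigenvalue_of A \<mu> \<Longrightarrow> Re \<mu> < 0"
    and "controllable A B"
    and "brownian_motion M W"
    and "stationary_solution M W A B v"
    and "V = (\<lambda>t x. \<alpha> \<bullet> v t x)"
    and "a = transpose A *v \<alpha>"
    and "\<gamma> = transpose B *v \<alpha>"
  shows
    "(AE x in M. \<forall>s t. s \<le> t \<longrightarrow>
        V t x - V s x = integral {s..t} (\<lambda>r. a \<bullet> v r x) + \<gamma> \<bullet> (W t x - W s x)) \<and>
     (\<forall>\<omega>. \<omega> \<noteq> 0 \<longrightarrow>
        complex_of_real (lambda2 A B a \<gamma> \<omega>) = complex_of_real pi * power_spectral_density M V \<omega>)"
proof (intro conjI allI impI)
  have "solves_linear_sde M W A B v"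
    using assms(4) by (simp add: stationary_solution_def)
  then show "AE x in M. \<forall>s t. s \<le> t \<longrightarrow>
      V t x - V s x = integral {s..t} (\<lambda>r. a \<bullet> v r x) + \<gamma> \<bullet> (W t x - W s x)"
    unfolding assms(5-7) by (rule linear_observable_increment)
next
  fix \<omega> :: real
  assume "\<omega> \<noteq> 0"
  \<comment> \<open>The decay constants are known only existentially, so the locale is interpreted
    inside the proof. They do not occur in the resulting identities.\<close>
  obtain K l where "l > 0" "\<forall>t\<ge>0. norm (mexp (t *\<^sub>R A)) \<le> K * exp (- l * t)"
    using mexp_exponential_decay assms(1) by blast
  then interpret stable_matrix A K l
    by unfold_locales auto
  show "complex_of_real (lambda2 A B a \<gamma> \<omega>) = complex_of_real pi * power_spectral_density M V \<omega>"
    unfolding assms(5-7) lambda2_eq_cosine_integral [OF \<open>\<omega> \<noteq> 0\<close>]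
    by (rule stationary_power_spectral_density [OF assms(3,4), symmetric])
qed

end
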